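(* Let $m\ge2$ be an integer. For $k=1,\ldots,m$ let $\mathbf{q}^{(k)}\in[1,2]^m$ be the $m$-tuple whose $k$-th entry is $1$ and whose other entries are all $2$. Then $$C_{\mathbf{q}^{(1)}m}=C_{\mathbf{q}^{(2)}m}=\cdots=C_{\mathbf{q}^{(m)}m}=\left(\sqrt2\right)^{m-1},$$ and, for every $k=1,\ldots,m$, $$2^{m-1}\le\mathrm{ent}_m(\mathbf{q}^{(k)})\le4^{m-1}.$$
   Context: $c_0$ is the real Banach space of real null sequences with the sup norm, $(e_j)$ its canonical basis, and $\|T\|$ is the usual sup norm of an $m$-linear form over the product of closed unit balls. For $\mathbf{q}=(q_1,\ldots,q_m)\in[1,2]^m$ with $\frac1{q_1}+\cdots+\frac1{q_m}\le\frac{m+1}{2}$ (a Bohnenblust--Hille exponent), $C_{\mathbf{q}m}$ denotes the optimal (smallest) constant $C$ such that $$\left(\sum_{j_1=1}^{\infty}\left(\sum_{j_2=1}^{\infty}\left(\cdots\left(\sum_{j_m=1}^{\infty}|T(e_{j_1},\ldots,e_{j_m})|^{q_m}\right)^{\frac{q_{m-1}}{q_m}}\cdots\right)^{\frac{q_2}{q_3}}\right)^{\frac{q_1}{q_2}}\right)^{\frac1{q_1}}\le C\|T\|$$ for all continuous $m$-linear forms $T\colon c_0\times\cdots\times c_0\to\mathbb{R}$; such a finite constant exists. The entropy $\mathrm{ent}_m(\mathbf{q})$ is the infimum of $\operatorname{card}\{(i_1,\ldots,i_m):\alpha_{i_1,\ldots,i_m}\ne0\}$ over all nonzero continuous $m$-linear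 forms $T\colon c_0\times\cdots\times c_0\to\mathbb{R}$, $T(x^{(1)},\ldots,x^{(m)})=\sum_{i_1,\ldots,i_m=1}^{\infty}\alpha_{i_1,\ldots,i_m}x^{(1)}_{i_1}\cdots x^{(m)}_{i_m}$, for which equality holds in the displayed inequality with $C=C_{\mathbf{q}m}$; if no such $T$ exists, $\mathrm{ent}_m(\mathbf{q})=\infty$. *)

theory Defs
  imports "HOL-Analysis.Analysis"
begin

section \<open>The Banach space of real null sequences\<close>

text \<open>Sequences are indexed from 0 here, and likewise the canonical basis; the slots of an
  m-linear form are indexed by {1..m}.\<close>

typedef c0 = "{f :: nat \<Rightarrow> real. f \<longlonglongrightarrow> 0}"
  morphisms c0_nth Abs_c0
  by (rule exI[of _ "\<lambda>_. 0"]) simp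

setup_lifting type_definition_c0

lemma c0_nth_tendsto: "c0_nth x \<longlonglongrightarrow> 0"
  using c0_nth[of x] by simp

lemma c0_eqI: "(\<And>n. c0_nth x n = c0_nth y n) \<Longrightarrow> x = y"
  by (metis c0_nth_inject ext)

lemma c0_bdd_above: "bdd_above (range (\<lambda>n. \<bar>c0_nth x n\<bar>))"
proof -
  have "Bseq (c0_nth x)"
    using c0_nth_tendsto convergent_imp_Bseq convergentI by blast
  then obtain K where "\<And>n. norm (c0_nth x n) \<le> K"
    by (rule BseqE) blast
  then show ?thesis by (intro bdd_aboveI[of _ K]) auto
qed

instantiation c0 :: real_normed_vector
begin

lift_definition zero_c0 :: c0 is "\<lambda>_. 0" by simp

lift_definition plus_c0 :: "c0 \<Rightarrow> c0 \<Rightarrow> c0" is "\<lambda>f g n. f n + g n"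
  using tendsto_add by fastforce

lift_definition minus_c0 :: "c0 \<Rightarrow> c0 \<Rightarrow> c0" is "\<lambda>f g n. f n - g n"
  using tendsto_diff by fastforce

lift_definition uminus_c0 :: "c0 \<Rightarrow> c0" is "\<lambda>f n. - f n"
  using tendsto_minus by fastforce

lift_definition scaleR_c0 :: "real \<Rightarrow> c0 \<Rightarrow> c0" is "\<lambda>r f n. r * f n"
  using tendsto_mult_right_zero by blast

definition norm_c0 :: "c0 \<Rightarrow> real"
  where "norm_c0 x = (SUP n. \<bar>c0_nth x n\<bar>)"

definition dist_c0 :: "c0 \<Rightarrow> c0 \<Rightarrow> real"
  where "dist_c0 x y = norm (x - y)"

definition sgn_c0 :: "c0 \<Rightarrow> c0"
  where "sgn_c0 x = inverse (norm x) *\<^sub>R x"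

definition uniformity_c0 :: "(c0 \<times> c0) filter"
  where "uniformity_c0 = (INF e\<in>{0<..}. principal {(x, y). dist x y < e})"

definition open_c0 :: "c0 set \<Rightarrow> bool"
  where "open_c0 U \<longleftrightarrow> (\<forall>x\<in>U. \<forall>\<^sub>F (x', y) in uniformity. x' = x \<longrightarrow> y \<in> U)"

instance
proof
  fix x y z :: c0 and a b :: real
  have le: "\<bar>c0_nth w n\<bar> \<le> norm w" for w n
    unfolding norm_c0_def by (rule cSUP_upper[OF UNIV_I c0_bdd_above])
  show "x + y + z = x + (y + z)" "x + y = y + x" "0 + x = x" "- x + x = 0" "x - y = x + - y"
    "a *\<^sub>R (x + y) = a *\<^sub>R x + a *\<^sub>R y" "(a + b) *\<^sub>R x = a *\<^sub>R x + b *\<^sub>R x"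
    "a *\<^sub>R b *\<^sub>R x = (a * b) *\<^sub>R x" "1 *\<^sub>R x = x"
    by (transfer; simp add: algebra_simps)+
  show "dist x y = norm (x - y)" by (rule dist_c0_def)
  show "sgn x = inverse (norm x) *\<^sub>R x" by (rule sgn_c0_def)
  show "uniformity = (INF e\<in>{0<..}. principal {(x :: c0, y). dist x y < e})"
    by (rule uniformity_c0_def)
  show "open U \<longleftrightarrow> (\<forall>x\<in>U. \<forall>\<^sub>F (x', y) in uniformity. x' = x \<longrightarrow> y \<in> U)" for U :: "c0 set"
    by (rule open_c0_def)
  show "norm x = 0 \<longleftrightarrow> x = 0"
  proof
    assume "norm x = 0"
    then have "c0_nth x n = 0" for n using le[of x n] by simp
    then show "x = 0" by (intro c0_eqI) (simp add: zero_c0.rep_eq)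
  qed (simp add: norm_c0_def zero_c0.rep_eq)
  show "norm (x + y) \<le> norm x + norm y"
    unfolding norm_c0_def[of "x + y"]
  proof (rule cSUP_least)
    fix n
    show "\<bar>c0_nth (x + y) n\<bar> \<le> norm x + norm y"
      using le[of x n] le[of y n] by (simp add: plus_c0.rep_eq)
  qed simp
  have scale: "norm (c *\<^sub>R w) \<le> \<bar>c\<bar> * norm w" for c and w :: c0
    unfolding norm_c0_def[of "c *\<^sub>R w"]
  proof (rule cSUP_least)
    fix n
    show "\<bar>c0_nth (c *\<^sub>R w) n\<bar> \<le> \<bar>c\<bar> * norm w"
      using le[of w n] by (simp add: scaleR_c0.rep_eq abs_mult mult_left_mono)
  qed simp
  show "norm (a *\<^sub>R x) = \<bar>a\<bar> * norm x"
  proof (cases "a = 0")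
    case True
    then have "a *\<^sub>R x = 0" by (intro c0_eqI) (simp add: scaleR_c0.rep_eq zero_c0.rep_eq)
    then show ?thesis using True by (simp add: norm_c0_def zero_c0.rep_eq)
  next
    case False
    have "inverse a *\<^sub>R (a *\<^sub>R x) = x"
      using False by (intro c0_eqI) (simp add: scaleR_c0.rep_eq)
    then have "norm x \<le> \<bar>inverse a\<bar> * norm (a *\<^sub>R x)"
      using scale[of "inverse a" "a *\<^sub>R x"] by simp
    then have "\<bar>a\<bar> * norm x \<le> norm (a *\<^sub>R x)"
      using False by (simp add: field_simps)
    then show ?thesis using scale[of a x] by simp
  qed
qed

end

lemma c0_nth_le_norm: "\<bar>c0_nth x n\<bar> \<le> norm x"
  unfolding norm_c0_def by (rule cSUP_upper[OF UNIV_I c0_bdd_above])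

lemma c0_norm_le: "(\<And>n. \<bar>c0_nth x n\<bar> \<le> K) \<Longrightarrow> norm x \<le> K"
  unfolding norm_c0_def by (rule cSUP_least) auto

instance c0 :: banach
proof
  fix X :: "nat \<Rightarrow> c0"
  assume X: "Cauchy X"
  have "Cauchy (\<lambda>k. c0_nth (X k) n)" for n
  proof (rule metric_CauchyI)
    fix e :: real assume "e > 0"
    then obtain M where M: "\<And>i j. i \<ge> M \<Longrightarrow> j \<ge> M \<Longrightarrow> norm (X i - X j) < e"
      using X \<open>e > 0\<close> by (metis CauchyD)
    have "dist (c0_nth (X i) n) (c0_nth (X j) n) < e" if "i \<ge> M" "j \<ge> M" for i j
      using c0_nth_le_norm[of "X i - X j" n] M[OF that] by (simp add: minus_c0.rep_eq dist_real_def)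
    then show "\<exists>M. \<forall>i\<ge>M. \<forall>j\<ge>M. dist (c0_nth (X i) n) (c0_nth (X j) n) < e" by blast
  qed
  then have "\<forall>n. \<exists>l. (\<lambda>k. c0_nth (X k) n) \<longlonglongrightarrow> l"
    using Cauchy_convergent convergent_def by blast
  then obtain l where l: "\<And>n. (\<lambda>k. c0_nth (X k) n) \<longlonglongrightarrow> l n" by metis
  have unif: "\<exists>M. \<forall>i\<ge>M. \<forall>n. \<bar>c0_nth (X i) n - l n\<bar> \<le> e" if "e > 0" for e :: real
  proof -
    obtain M where M: "\<And>i j. i \<ge> M \<Longrightarrow> j \<ge> M \<Longrightarrow> norm (X i - X j) < e"
      using X \<open>e > 0\<close> by (metis CauchyD)
    have "\<bar>c0_nth (X i) n - l n\<bar> \<le> e" if "i \<ge> M" for i n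
    proof (rule tendsto_upperbound)
      show "(\<lambda>j. \<bar>c0_nth (X i) n - c0_nth (X j) n\<bar>) \<longlonglongrightarrow> \<bar>c0_nth (X i) n - l n\<bar>"
        by (intro tendsto_intros l)
      show "\<forall>\<^sub>F j in sequentially. \<bar>c0_nth (X i) n - c0_nth (X j) n\<bar> \<le> e"
        using eventually_ge_at_top[of M]
      proof eventually_elim
        case (elim j)
        then show ?case
          using c0_nth_le_norm[of "X i - X j" n] M[OF that, of j] by (simp add: minus_c0.rep_eq)
      qed
    qed simp
    then show ?thesis by blast
  qed
  have "l \<longlonglongrightarrow> 0"
  proof (rule LIMSEQ_I)
    fix e :: real assume "e > 0"
    then obtain M where M: "\<And>n. \<bar>c0_nth (X M) n - l n\<bar> \<le> e / 2"
      using unif[of "e / 2"] by auto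
    obtain N where "\<And>n. n \<ge> N \<Longrightarrow> \<bar>c0_nth (X M) n\<bar> < e / 2"
      using LIMSEQ_D[OF c0_nth_tendsto[of "X M"], of "e / 2"] \<open>e > 0\<close> by auto
    then have "norm (l n - 0) < e" if "n \<ge> N" for n
      using M[of n] that by (smt (verit) field_sum_of_halves real_norm_def)
    then show "\<exists>N. \<forall>n\<ge>N. norm (l n - 0) < e" by blast
  qed
  then have nth: "c0_nth (Abs_c0 l) = l" by (simp add: Abs_c0_inverse)
  have "X \<longlonglongrightarrow> Abs_c0 l"
  proof (rule LIMSEQ_I)
    fix e :: real assume "e > 0"
    then obtain M where M: "\<And>i n. i \<ge> M \<Longrightarrow> \<bar>c0_nth (X i) n - l n\<bar> \<le> e / 2"
      using unif[of "e / 2"] by auto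
    have "norm (X i - Abs_c0 l) \<le> e / 2" if "i \<ge> M" for i
      by (rule c0_norm_le) (use M[OF that] in \<open>simp add: minus_c0.rep_eq nth\<close>)
    then have "norm (X i - Abs_c0 l) < e" if "i \<ge> M" for i
      using that \<open>e > 0\<close> by (smt (verit) field_sum_of_halves)
    then show "\<exists>M. \<forall>i\<ge>M. norm (X i - Abs_c0 l) < e" by blast
  qed
  then show "convergent X" by (rule convergentI)
qed

lift_definition c0_basis :: "nat \<Rightarrow> c0" is "\<lambda>j n. if n = j then 1 else 0"
proof -
  fix j :: nat
  have "\<forall>\<^sub>F n in sequentially. (if n = j then 1 else 0 :: real) = 0"
    using eventually_gt_at_top[of j] by eventually_elim simp
  then show "(\<lambda>n. if n = j then 1 else 0 :: real) \<longlonglongrightarrow> 0"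
    by (rule tendsto_eventually)
qed


section \<open>Continuous multilinear forms\<close>

text \<open>An m-tuple of vectors is an element of \<^term>\<open>{1..m} \<rightarrow>\<^sub>E (UNIV :: c0 set)\<close>; the values of
  a form outside this set are irrelevant, and none of the notions below depends on them.\<close>

definition tuples :: "nat \<Rightarrow> (nat \<Rightarrow> 'a) set"
  where "tuples m = ({1..m} \<rightarrow>\<^sub>E UNIV)"

definition cont_multilinear_form :: "nat \<Rightarrow> ((nat \<Rightarrow> c0) \<Rightarrow> real) \<Rightarrow> bool"
  where "cont_multilinear_form m T \<longleftrightarrow>
    (\<forall>x\<in>tuples m. \<forall>k\<in>{1..m}. linear (\<lambda>v. T (x(k := v)))) \<and>
    continuous_map (product_topology (\<lambda>_. euclidean) {1..m}) euclideanreal T"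

definition form_norm :: "nat \<Rightarrow> ((nat \<Rightarrow> c0) \<Rightarrow> real) \<Rightarrow> ennreal"
  where "form_norm m T = (SUP x\<in>({1..m} \<rightarrow>\<^sub>E cball 0 1). ennreal \<bar>T x\<bar>)"

text \<open>The coefficient of \<open>T\<close> at the multi-index \<open>i\<close>. Evaluating
  \<open>T(x\<^sub>1,\<dots>,x\<^sub>m) = \<Sum> \<alpha>\<^sub>i x\<^sub>1(i\<^sub>1) \<dots> x\<^sub>m(i\<^sub>m)\<close> at basis vectors gives \<open>\<alpha>\<^sub>i\<close>.\<close>

definition coefficient :: "nat \<Rightarrow> ((nat \<Rightarrow> c0) \<Rightarrow> real) \<Rightarrow> (nat \<Rightarrow> nat) \<Rightarrow> real"
  where "coefficient m T i = T (\<lambda>k\<in>{1..m}. c0_basis (i k))"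


section \<open>The Bohnenblust--Hille constant and the entropy\<close>

text \<open>Real powers on \<open>[0,\<infinity>]\<close>; only used for exponents \<open>p > 0\<close>, which is why \<open>\<infinity>\<close> is sent
  to \<open>\<infinity>\<close>.\<close>

definition epowr :: "ennreal \<Rightarrow> real \<Rightarrow> ennreal"  (infixr "epowr" 80)
  where "x epowr p = (if x = \<infinity> then \<infinity> else ennreal (enn2real x powr p))"

text \<open>\<open>nested_sum q a [k, \<dots>, m] i\<close> is the part of the nested sum that starts at the summation
  over \<open>j\<^sub>k\<close>, i.e.
  \<open>\<Sum>j\<^sub>k (\<Sum>j\<^sub>k\<^sub>+\<^sub>1 (\<dots> (\<Sum>j\<^sub>m |a j|^q\<^sub>m)^(q\<^sub>m\<^sub>-\<^sub>1/q\<^sub>m) \<dots>)^(q\<^sub>k\<^sub>+\<^sub>1/q\<^sub>k\<^sub>+\<^sub>2))^(q\<^sub>k/q\<^sub>k\<^sub>+\<^sub>1)\<close>,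
  where the earlier indices have the values prescribed by \<open>i\<close>.\<close>

fun nested_sum ::
    "(nat \<Rightarrow> real) \<Rightarrow> ((nat \<Rightarrow> nat) \<Rightarrow> real) \<Rightarrow> nat list \<Rightarrow> (nat \<Rightarrow> nat) \<Rightarrow> ennreal"
  where
    "nested_sum q a [] i = ennreal \<bar>a i\<bar>"
  | "nested_sum q a [k] i = (\<Sum>j. ennreal \<bar>a (i(k := j))\<bar> epowr q k)"
  | "nested_sum q a (k # l # ks) i =
       (\<Sum>j. nested_sum q a (l # ks) (i(k := j)) epowr (q k / q l))"

definition mixed_norm :: "nat \<Rightarrow> (nat \<Rightarrow> real) \<Rightarrow> ((nat \<Rightarrow> c0) \<Rightarrow> real) \<Rightarrow> ennreal"
  where "mixed_norm m q T =
    nested_sum q (coefficient m T) [1..<Suc m] (\<lambda>_. undefined) epowr (1 / q 1)"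

definition bh_admissible :: "nat \<Rightarrow> (nat \<Rightarrow> real) \<Rightarrow> ennreal \<Rightarrow> bool"
  where "bh_admissible m q C \<longleftrightarrow>
    (\<forall>T. cont_multilinear_form m T \<longrightarrow> mixed_norm m q T \<le> C * form_norm m T)"

text \<open>The inequality is closed in \<open>C\<close>, so this infimum is the smallest admissible constant; it
  would be \<open>\<infinity>\<close> if no finite constant were admissible.\<close>

definition bh_const :: "nat \<Rightarrow> (nat \<Rightarrow> real) \<Rightarrow> ennreal"
  where "bh_const m q = Inf {C. bh_admissible m q C}"

text \<open>Infinite sets get \<open>\<infinity>\<close>, whereas \<^const>\<open>card\<close> would give 0.\<close>

definition ecard :: "'a set \<Rightarrow> enat"
  where "ecard A = (if finite A then enat (card A) else \<infinity>)"

definition bh_extremal :: "nat \<Rightarrow> (nat \<Rightarrow> real) \<Rightarrow> ((nat \<Rightarrow> c0) \<Rightarrow> real) \<Rightarrow> bool"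
  where "bh_extremal m q T \<longleftrightarrow>
    cont_multilinear_form m T \<and> (\<exists>x\<in>tuples m. T x \<noteq> 0) \<and>
    mixed_norm m q T = bh_const m q * form_norm m T"

text \<open>The infimum is taken in \<^typ>\<open>enat\<close>, so that it is \<open>\<infinity>\<close> if there is no extremal form.\<close>

definition entropy :: "nat \<Rightarrow> (nat \<Rightarrow> real) \<Rightarrow> enat"
  where "entropy m q =
    (INF T\<in>{T. bh_extremal m q T}. ecard {i \<in> tuples m. coefficient m T i \<noteq> 0})"

definition one_two_tuple :: "nat \<Rightarrow> nat \<Rightarrow> real"
  where "one_two_tuple k = (\<lambda>j. if j = k then 1 else 2)"

end

theory Submission
  imports Defs
begin

text \<open>Write \<open>a\<close> for the coefficients of a form \<open>T\<close>. Two estimates bound its mixed norm from above.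
  By Minkowski's inequality, pulling the exponent 1 in slot \<open>k\<close> to the outside only enlarges the
  norm, so it suffices to consider \<open>\<Sum>j\<^sub>k (\<Sum>(other indices) a\<^sup>2)\<^sup>1\<^sup>/\<^sup>2\<close>. All this is done for
  indices below some \<open>n\<close>; the infinite sums are suprema of these truncations.

  The first estimate replaces the other slots one by one by random sign vectors \<open>\<Sum>j \<plusminus>e\<^sub>j\<close>. Each
  replacement costs a factor \<open>\<surd>2\<close> by Khinchine's \<open>L\<^sub>1\<close>-\<open>L\<^sub>2\<close> inequality with its optimal constant, for
  vectors in a Euclidean space (\<open>vector_khinchine\<close>); what remains is \<open>\<Sum>j \<bar>T(\<dots>, e\<^sub>j, \<dots>)\<bar>\<close> with sign
  vectors in the other slots, which is at most \<open>\<parallel>T\<parallel>\<close> because it is the value of \<open>T\<close> at a suitable sign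
  vector in slot \<open>k\<close>. So the constant is at most \<open>(\<surd>2)\<^sup>m\<^sup>-\<^sup>1\<close> (\<open>sum_L2_set_coefficient_le\<close>). The
  vector-valued form of Khinchine's inequality is what makes this iteration immediate; its proof
  is that of Latala and Oleszkiewicz, which rests on an improved Poincare inequality on the cube.

  The second estimate uses only that an average over signs dominates each single coefficient. It
  gives \<open>\<Sum>j max \<bar>a\<bar> \<le> \<parallel>T\<parallel>\<close>, the maximum being over the other indices, and hence bounds the mixed
  norm by \<open>\<surd>s \<parallel>T\<parallel>\<close> for a form with \<open>s\<close> nonzero coefficients
  (\<open>sum_L2_set_coefficient_le_support\<close>). A form that attains the ratio \<open>(\<surd>2)\<^sup>m\<^sup>-\<^sup>1\<close> therefore has
  \<open>s \<ge> 2\<^sup>m\<^sup>-\<^sup>1\<close>.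

  The remaining bounds come from one form. It pairs \<open>2\<^sup>m\<^sup>-\<^sup>1\<close> coordinates in slot \<open>k\<close> with the sign
  patterns on the other slots, and multiplies each with the corresponding product of the factors
  \<open>x\<^sub>0 \<plusminus> x\<^sub>1\<close>. Its \<open>4\<^sup>m\<^sup>-\<^sup>1\<close> nonzero coefficients are \<open>\<plusminus>1\<close>, so its mixed norm is
  \<open>2\<^sup>m\<^sup>-\<^sup>1 (\<surd>2)\<^sup>m\<^sup>-\<^sup>1\<close>, and its norm is at most \<open>2\<^sup>m\<^sup>-\<^sup>1\<close> since \<open>\<bar>s - t\<bar> + \<bar>s + t\<bar> \<le> 2\<close> for \<open>\<bar>s\<bar>, \<bar>t\<bar> \<le> 1\<close>.\<close>

section \<open>Functions on the discrete cube\<close>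

text \<open>A point of the cube \<open>{-1, 1}\<^sup>I\<close> is represented by the set \<open>S \<subseteq> I\<close> of its coordinates equal to \<open>-1\<close>.
  Thus \<open>flip i\<close> changes one sign, the complement in \<open>I\<close> is the antipodal point, and \<open>avg\<close> is the
  expectation under independent uniform signs.\<close>

definition flip :: "'i \<Rightarrow> 'i set \<Rightarrow> 'i set"
  where "flip i S = (if i \<in> S then S - {i} else insert i S)"

definition avg :: "'i set \<Rightarrow> ('i set \<Rightarrow> real) \<Rightarrow> real"
  where "avg I F = (\<Sum>S\<in>Pow I. F S) / 2 ^ card I"

text \<open>The Dirichlet form: for \<open>F = \<Sum>A c\<^sub>A w\<^sub>A\<close> with the Walsh functions
  \<open>w\<^sub>A = \<Prod>i\<in>A \<epsilon>\<^sub>i\<close>, this is \<open>\<Sum>A \<bar>A\<bar> c\<^sub>A\<^sup>2\<close>.\<close>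

definition energy :: "'i set \<Rightarrow> ('i set \<Rightarrow> real) \<Rightarrow> real"
  where "energy I F = (\<Sum>i\<in>I. avg I (\<lambda>S. ((F S - F (flip i S)) / 2)\<^sup>2))"

definition odd_part :: "'i set \<Rightarrow> ('i set \<Rightarrow> real) \<Rightarrow> 'i set \<Rightarrow> real"
  where "odd_part I F S = (F S - F (I - S)) / 2"

definition even_part :: "'i set \<Rightarrow> ('i set \<Rightarrow> real) \<Rightarrow> 'i set \<Rightarrow> real"
  where "even_part I F S = (F S + F (I - S)) / 2"

lemma avg_cong: "(\<And>S. S \<subseteq> I \<Longrightarrow> F S = G S) \<Longrightarrow> avg I F = avg I G"
  by (simp add: avg_def)

lemma avg_mono: "(\<And>S. S \<subseteq> I \<Longrightarrow> F S \<le> G S) \<Longrightarrow> avg I F \<le> avg I G"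
  by (auto simp: avg_def intro!: divide_right_mono sum_mono)

lemma avg_nonneg: "(\<And>S. S \<subseteq> I \<Longrightarrow> 0 \<le> F S) \<Longrightarrow> 0 \<le> avg I F"
  unfolding avg_def by (intro divide_nonneg_nonneg sum_nonneg) auto

lemma avg_add: "avg I (\<lambda>S. F S + G S) = avg I F + avg I G"
  by (simp add: avg_def sum.distrib add_divide_distrib)

lemma avg_diff: "avg I (\<lambda>S. F S - G S) = avg I F - avg I G"
  by (simp add: avg_def sum_subtractf diff_divide_distrib)

lemma avg_cmult: "avg I (\<lambda>S. c * F S) = c * avg I F"
  by (simp add: avg_def sum_distrib_left)

lemma avg_divide: "avg I (\<lambda>S. F S / c) = avg I F / c"
  using avg_cmult[of I "inverse c" F] by (simp add: field_simps)

lemma avg_const: "finite I \<Longrightarrow> avg I (\<lambda>S. c) = c"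
  by (simp add: avg_def card_Pow)

lemma avg_sum: "avg I (\<lambda>S. \<Sum>j\<in>J. F j S) = (\<Sum>j\<in>J. avg I (F j))"
  by (simp add: avg_def sum_divide_distrib sum.swap[of _ "Pow I"])

lemma avg_insert:
  assumes "finite I" "n \<notin> I"
  shows "avg (insert n I) F = avg I (\<lambda>S. (F S + F (insert n S)) / 2)"
proof -
  have disj: "Pow I \<inter> insert n ` Pow I = {}" using assms by auto
  have inj: "inj_on (insert n) (Pow I)" using assms by (auto simp: inj_on_def)
  have "(\<Sum>S\<in>Pow (insert n I). F S) = (\<Sum>S\<in>Pow I. F S) + (\<Sum>S\<in>Pow I. F (insert n S))"
    unfolding Pow_insert using assms disj
    by (simp add: sum.union_disjoint sum.reindex[OF inj])
  then show ?thesis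
    using assms by (simp add: avg_def sum.distrib field_simps flip: sum_divide_distrib)
qed

lemma avg_complement: "avg I (\<lambda>S. F (I - S)) = avg I F"
  unfolding avg_def
  by (rule arg_cong[where f = "\<lambda>s. s / _"],
      rule sum.reindex_bij_witness[of _ "\<lambda>S. I - S" "\<lambda>S. I - S"]) auto

lemma flip_flip: "flip i (flip i S) = S"
  by (auto simp: flip_def)

lemma avg_flip: "i \<in> I \<Longrightarrow> avg I (\<lambda>S. F (flip i S)) = avg I F"
  unfolding avg_def
  by (rule arg_cong[where f = "\<lambda>s. s / _"],
      rule sum.reindex_bij_witness[of _ "flip i" "flip i"]) (auto simp: flip_flip, auto simp: flip_def split: if_splits)

text \<open>On a cube with one more coordinate \<open>n\<close>, every function is \<open>s + \<epsilon>\<^sub>n d\<close>, where \<open>s\<close> and \<open>d\<close> live on the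
  smaller cube. This splitting drives all inductions below.\<close>

lemma energy_insert:
  fixes F :: "'i set \<Rightarrow> real"
  defines "s \<equiv> \<lambda>S. \<lambda>n. (F S + F (insert n S)) / 2"
      and "d \<equiv> \<lambda>S. \<lambda>n. (F S - F (insert n S)) / 2"
  assumes "finite I" "n \<notin> I"
  shows "energy (insert n I) F =
    energy I (\<lambda>S. s S n) + energy I (\<lambda>S. d S n) + avg I (\<lambda>S. (d S n)\<^sup>2)"
proof -
  let ?e = "\<lambda>i. avg (insert n I) (\<lambda>S. ((F S - F (flip i S)) / 2)\<^sup>2)"
  have n: "?e n = avg I (\<lambda>S. (d S n)\<^sup>2)"
    unfolding avg_insert[OF assms(3,4)]
    using assms(4) by (intro avg_cong) (auto simp: flip_def d_def power2_eq_square field_simps)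
  have i: "?e i = avg I (\<lambda>S. ((s S n - s (flip i S) n) / 2)\<^sup>2)
      + avg I (\<lambda>S. ((d S n - d (flip i S) n) / 2)\<^sup>2)" if "i \<in> I" for i
  proof -
    have "i \<noteq> n" using that assms by auto
    then have f: "flip i (insert n S) = insert n (flip i S)" for S
      by (auto simp: flip_def)
    show ?thesis
      unfolding avg_insert[OF assms(3,4)] avg_add[symmetric] f
      by (intro avg_cong) (simp add: s_def d_def power2_eq_square field_simps)
  qed
  show ?thesis
    unfolding energy_def using assms(3,4) n by (simp add: i sum.distrib)
qed

text \<open>Multiplying by the sign \<open>\<epsilon>\<^sub>n\<close> exchanges parity, so the odd part of \<open>s + \<epsilon>\<^sub>n d\<close> consists of the
  odd part of \<open>s\<close> and the even part of \<open>d\<close>.\<close>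

lemma avg_odd_part_insert:
  fixes F :: "'i set \<Rightarrow> real"
  defines "s \<equiv> \<lambda>S. \<lambda>n. (F S + F (insert n S)) / 2"
      and "d \<equiv> \<lambda>S. \<lambda>n. (F S - F (insert n S)) / 2"
  assumes "finite I" "n \<notin> I"
  shows "avg (insert n I) (\<lambda>S. (odd_part (insert n I) F S)\<^sup>2) =
    avg I (\<lambda>S. (odd_part I (\<lambda>S. s S n) S)\<^sup>2) + avg I (\<lambda>S. (even_part I (\<lambda>S. d S n) S)\<^sup>2)"
  unfolding avg_insert[OF assms(3,4)] avg_add[symmetric]
proof (intro avg_cong)
  fix S assume "S \<subseteq> I"
  then have "insert n I - S = insert n (I - S)" "insert n I - insert n S = I - S"
    using assms(4) by auto
  then show "((odd_part (insert n I) F S)\<^sup>2 + (odd_part (insert n I) F (insert n S))\<^sup>2) / 2 =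
      (odd_part I (\<lambda>S. s S n) S)\<^sup>2 + (even_part I (\<lambda>S. d S n) S)\<^sup>2"
    by (simp add: odd_part_def even_part_def s_def d_def power2_eq_square field_simps)
qed

lemma avg_even_odd_part:
  "avg I (\<lambda>S. (even_part I F S)\<^sup>2) + avg I (\<lambda>S. (odd_part I F S)\<^sup>2) = avg I (\<lambda>S. (F S)\<^sup>2)"
proof -
  have "avg I (\<lambda>S. (even_part I F S)\<^sup>2) + avg I (\<lambda>S. (odd_part I F S)\<^sup>2)
      = avg I (\<lambda>S. (F S)\<^sup>2 / 2 + (F (I - S))\<^sup>2 / 2)"
    unfolding avg_add[symmetric]
    by (intro avg_cong) (simp add: even_part_def odd_part_def power2_eq_square field_simps)
  also have "\<dots> = avg I (\<lambda>S. (F S)\<^sup>2)"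
    using avg_complement[of I "\<lambda>S. (F S)\<^sup>2"] by (simp add: avg_add avg_divide)
  finally show ?thesis .
qed

text \<open>In the Walsh expansion: odd sets satisfy \<open>1 \<le> \<bar>A\<bar>\<close>.\<close>

lemma avg_odd_part_le_energy:
  "finite I \<Longrightarrow> avg I (\<lambda>S. (odd_part I F S)\<^sup>2) \<le> energy I F"
proof (induction I arbitrary: F rule: finite_induct)
  case empty
  then show ?case by (simp add: avg_def energy_def odd_part_def)
next
  case (insert n I)
  let ?d = "\<lambda>S. (F S - F (insert n S)) / 2"
  have "avg I (\<lambda>S. (even_part I ?d S)\<^sup>2) \<le> avg I (\<lambda>S. (?d S)\<^sup>2)"
    using avg_even_odd_part[of I ?d] avg_nonneg[of I "\<lambda>S. (odd_part I ?d S)\<^sup>2"] by simp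
  moreover have "0 \<le> energy I ?d"
    unfolding energy_def by (intro sum_nonneg avg_nonneg) simp
  ultimately show ?case
    unfolding avg_odd_part_insert[OF insert(1,2)] energy_insert[OF insert(1,2)]
    using insert.IH[of "\<lambda>S. (F S + F (insert n S)) / 2"] by linarith
qed

text \<open>In the Walsh expansion: \<open>2 \<le> \<bar>A\<bar> + 1\<close> for odd \<open>\<bar>A\<bar>\<close> and \<open>2 \<le> \<bar>A\<bar>\<close> for even \<open>\<bar>A\<bar> > 0\<close>. For even
  functions the last term vanishes, and the usual Poincare inequality is improved by a factor 2.
  Keeping the term makes the statement hold for all functions, as the induction requires.\<close>

lemma improved_poincare:
  "finite I \<Longrightarrow> 2 * (avg I (\<lambda>S. (F S)\<^sup>2) - (avg I F)\<^sup>2)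
     \<le> energy I F + avg I (\<lambda>S. (odd_part I F S)\<^sup>2)"
proof (induction I arbitrary: F rule: finite_induct)
  case empty
  then show ?case by (simp add: avg_def energy_def odd_part_def)
next
  case (insert n I)
  let ?s = "\<lambda>S. (F S + F (insert n S)) / 2"
  let ?d = "\<lambda>S. (F S - F (insert n S)) / 2"
  have "avg (insert n I) F = avg I ?s"
    by (rule avg_insert[OF insert(1,2)])
  moreover have "avg (insert n I) (\<lambda>S. (F S)\<^sup>2) = avg I (\<lambda>S. (?s S)\<^sup>2) + avg I (\<lambda>S. (?d S)\<^sup>2)"
    unfolding avg_insert[OF insert(1,2)] avg_add[symmetric]
    by (intro avg_cong) (simp add: power2_eq_square field_simps)
  ultimately show ?case
    unfolding avg_odd_part_insert[OF insert(1,2)] energy_insert[OF insert(1,2)]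
    using insert.IH[of ?s] avg_odd_part_le_energy[OF insert(1), of ?d] avg_even_odd_part[of I ?d]
    by simp
qed

section \<open>Khinchine's inequality with the optimal constant\<close>

text \<open>The hypothesis on flips says that the generator of the random walk on the cube decreases \<open>X\<close> by
  at most \<open>X\<close> itself, so the energy of \<open>X\<close> is at most \<open>E X\<^sup>2\<close>. With the improved Poincare inequality
  \<open>2 (E X\<^sup>2 - (E X)\<^sup>2) \<le> E X\<^sup>2\<close> follows.\<close>

lemma latala_oleszkiewicz:
  fixes X :: "'i set \<Rightarrow> real"
  assumes fin: "finite I"
    and nonneg: "\<And>S. S \<subseteq> I \<Longrightarrow> 0 \<le> X S"
    and even: "\<And>S. S \<subseteq> I \<Longrightarrow> X (I - S) = X S"
    and flips: "\<And>S. S \<subseteq> I \<Longrightarrow> (real (card I) - 2) * X S \<le> (\<Sum>i\<in>I. X (flip i S))"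
  shows "avg I (\<lambda>S. (X S)\<^sup>2) \<le> 2 * (avg I X)\<^sup>2"
proof -
  have "avg I (\<lambda>S. (odd_part I X S)\<^sup>2) = avg I (\<lambda>S. 0)"
    by (rule avg_cong) (simp add: odd_part_def even)
  then have odd: "avg I (\<lambda>S. (odd_part I X S)\<^sup>2) = 0" by (simp add: avg_def)
  have e: "avg I (\<lambda>S. ((X S - X (flip i S)) / 2)\<^sup>2)
      = avg I (\<lambda>S. (X S)\<^sup>2 / 2 - X S * X (flip i S) / 2)" if "i \<in> I" for i
  proof -
    have "avg I (\<lambda>S. ((X S - X (flip i S)) / 2)\<^sup>2)
       = avg I (\<lambda>S. (X S)\<^sup>2 / 4 + (X (flip i S))\<^sup>2 / 4 - X S * X (flip i S) / 2)"
      by (intro avg_cong) (simp add: power2_eq_square field_simps)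
    then show ?thesis
      using avg_flip[OF that, of "\<lambda>S. (X S)\<^sup>2"] by (simp add: avg_add avg_diff avg_divide)
  qed
  have "energy I X = avg I (\<lambda>S. \<Sum>i\<in>I. (X S)\<^sup>2 / 2 - X S * X (flip i S) / 2)"
    by (simp add: energy_def avg_sum e)
  also have "\<dots> \<le> avg I (\<lambda>S. (X S)\<^sup>2)"
  proof (rule avg_mono)
    fix S assume S: "S \<subseteq> I"
    have "(\<Sum>i\<in>I. (X S)\<^sup>2 / 2 - X S * X (flip i S) / 2)
        = card I * (X S)\<^sup>2 / 2 - X S * (\<Sum>i\<in>I. X (flip i S)) / 2"
      by (simp add: sum_subtractf sum_distrib_left flip: sum_divide_distrib)
    also have "\<dots> \<le> card I * (X S)\<^sup>2 / 2 - X S * ((real (card I) - 2) * X S) / 2"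
      using mult_left_mono[OF flips[OF S] nonneg[OF S]] by simp
    also have "\<dots> = (X S)\<^sup>2" by (simp add: power2_eq_square field_simps)
    finally show "(\<Sum>i\<in>I. (X S)\<^sup>2 / 2 - X S * X (flip i S) / 2) \<le> (X S)\<^sup>2" .
  qed
  finally show ?thesis
    using improved_poincare[OF fin, of X] odd by simp
qed

definition signed_sum :: "'i set \<Rightarrow> 'i set \<Rightarrow> ('i \<Rightarrow> 'b::real_vector) \<Rightarrow> 'b"
  where "signed_sum I S v = (\<Sum>j\<in>I. (if j \<in> S then -1 else 1) *\<^sub>R v j)"

lemma signed_sum_insert:
  assumes "finite I" "n \<notin> I" "S \<subseteq> I"
  shows "signed_sum (insert n I) S v = signed_sum I S v + v n"
    and "signed_sum (insert n I) (insert n S) v = signed_sum I S v - v n"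
proof -
  have "n \<notin> S" using assms by auto
  moreover have "signed_sum I (insert n S) v = signed_sum I S v"
    unfolding signed_sum_def using assms by (intro sum.cong) auto
  ultimately show "signed_sum (insert n I) S v = signed_sum I S v + v n"
    and "signed_sum (insert n I) (insert n S) v = signed_sum I S v - v n"
    using assms by (simp_all add: signed_sum_def)
qed

lemma avg_signed_sum_square:
  fixes b :: "'i \<Rightarrow> real"
  shows "finite I \<Longrightarrow> avg I (\<lambda>S. (signed_sum I S b)\<^sup>2) = (\<Sum>j\<in>I. (b j)\<^sup>2)"
proof (induction I rule: finite_induct)
  case empty
  then show ?case by (simp add: avg_def signed_sum_def)
next
  case (insert n I)
  have "avg (insert n I) (\<lambda>S. (signed_sum (insert n I) S b)\<^sup>2)
      = avg I (\<lambda>S. (signed_sum I S b)\<^sup>2 + (b n)\<^sup>2)"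
    unfolding avg_insert[OF insert(1,2)] using insert(1,2)
    by (intro avg_cong) (simp add: signed_sum_insert power2_eq_square field_simps)
  then show ?case using insert by (simp add: avg_add avg_const)
qed

text \<open>Averaging over the sign of the \<open>i\<close>-th term alone is enough: \<open>\<bar>u + b\<bar> + \<bar>u - b\<bar> \<ge> 2 \<bar>b\<bar>\<close>.\<close>

lemma abs_le_avg_signed_sum:
  fixes b :: "'i \<Rightarrow> real"
  assumes "finite I" "i \<in> I"
  shows "\<bar>b i\<bar> \<le> avg I (\<lambda>S. \<bar>signed_sum I S b\<bar>)"
proof -
  obtain J where J: "I = insert i J" "i \<notin> J" using assms(2) by (meson Set.set_insert)
  then have fin: "finite J" using assms(1) by simp
  have "\<bar>b i\<bar> = avg J (\<lambda>S. \<bar>b i\<bar>)" using fin by (simp add: avg_const)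
  also have "\<dots> \<le> avg I (\<lambda>S. \<bar>signed_sum I S b\<bar>)"
    unfolding J(1) avg_insert[OF fin J(2)]
    using fin J(2) by (intro avg_mono) (simp add: signed_sum_insert)
  finally show ?thesis .
qed

lemma L2_set_sum_le:
  "finite J \<Longrightarrow> L2_set (\<lambda>x. \<Sum>j\<in>J. f j x) A \<le> (\<Sum>j\<in>J. L2_set (f j) A)"
proof (induction J rule: finite_induct)
  case empty
  then show ?case by (simp add: L2_set_def)
next
  case (insert n J)
  then show ?case
    using L2_set_triangle_ineq[of "f n" "\<lambda>x. \<Sum>j\<in>J. f j x" A] by simp
qed

lemma L2_set_cmult: "L2_set (\<lambda>x. c * f x) A = \<bar>c\<bar> * L2_set f A"
  by (simp add: L2_set_def power_mult_distrib real_sqrt_mult flip: sum_distrib_left)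

text \<open>The Euclidean norm \<open>X\<close> of a signed sum of vectors satisfies the hypotheses of the previous
  result: it does not change when all signs do, and the \<open>card I\<close> sums that arise by flipping one sign
  add up to \<open>card I - 2\<close> times the original one, so the triangle inequality applies. Moreover
  \<open>E X\<^sup>2\<close> is the sum of the squared lengths, by orthogonality of the signs.\<close>

theorem vector_khinchine:
  fixes v :: "'i \<Rightarrow> 'b \<Rightarrow> real"
  assumes fin: "finite I"
  shows "L2_set (\<lambda>j. L2_set (v j) A) I
    \<le> sqrt 2 * avg I (\<lambda>S. L2_set (\<lambda>x. signed_sum I S (\<lambda>j. v j x)) A)"
proof -
  define X where "X = (\<lambda>S. L2_set (\<lambda>x. signed_sum I S (\<lambda>j. v j x)) A)"
  have nonneg: "0 \<le> X S" for S by (simp add: X_def L2_set_nonneg)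
  have even: "X (I - S) = X S" if "S \<subseteq> I" for S
  proof -
    have "signed_sum I (I - S) b = - signed_sum I S b" for b :: "'i \<Rightarrow> real"
      unfolding signed_sum_def sum_negf[symmetric] using that by (intro sum.cong) auto
    then show ?thesis by (simp add: X_def L2_set_def)
  qed
  have flips: "(real (card I) - 2) * X S \<le> (\<Sum>i\<in>I. X (flip i S))" if "S \<subseteq> I" for S
  proof -
    have flip: "signed_sum I (flip i S) b
        = signed_sum I S b - 2 * (if i \<in> S then -1 else 1) * b i"
      if "i \<in> I" for i and b :: "'i \<Rightarrow> real"
    proof -
      have "signed_sum I (flip i S) b = (if i \<in> S then 1 else -1) * b i
          + signed_sum (I - {i}) (flip i S) b"
        using that fin by (simp add: signed_sum_def sum.remove flip_def)
      moreover have "signed_sum I S b = (if i \<in> S then -1 else 1) * b i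
          + signed_sum (I - {i}) S b"
        using that fin by (simp add: signed_sum_def sum.remove)
      moreover have "signed_sum (I - {i}) (flip i S) b = signed_sum (I - {i}) S b"
        unfolding signed_sum_def by (intro sum.cong) (auto simp: flip_def)
      ultimately show ?thesis by simp
    qed
    have "(\<Sum>i\<in>I. signed_sum I (flip i S) b) = (real (card I) - 2) * signed_sum I S b" for b :: "'i \<Rightarrow> real"
    proof -
      have "(\<Sum>i\<in>I. signed_sum I (flip i S) b)
          = (\<Sum>i\<in>I. signed_sum I S b - 2 * ((if i \<in> S then -1 else 1) * b i))"
        by (intro sum.cong) (auto simp: flip)
      also have "\<dots> = card I * signed_sum I S b - 2 * signed_sum I S b"
        by (simp only: sum_subtractf sum_distrib_left[symmetric] sum_constant)
           (simp add: signed_sum_def)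
      finally show ?thesis by (simp add: algebra_simps)
    qed
    then have "(real (card I) - 2) * X S
        \<le> L2_set (\<lambda>x. \<Sum>i\<in>I. signed_sum I (flip i S) (\<lambda>j. v j x)) A"
      using nonneg[of S] by (simp add: X_def L2_set_cmult mult_right_mono)
    also have "\<dots> \<le> (\<Sum>i\<in>I. X (flip i S))"
      unfolding X_def by (rule L2_set_sum_le[OF fin])
    finally show ?thesis .
  qed
  have "(\<Sum>j\<in>I. (L2_set (v j) A)\<^sup>2) = avg I (\<lambda>S. (X S)\<^sup>2)"
  proof -
    have sq: "(L2_set f A)\<^sup>2 = (\<Sum>x\<in>A. (f x)\<^sup>2)" for f :: "'b \<Rightarrow> real"
      by (simp add: L2_set_def sum_nonneg)
    show ?thesis
      by (simp add: X_def sq avg_sum avg_signed_sum_square[OF fin] sum.swap[of _ I])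
  qed
  also have "\<dots> \<le> 2 * (avg I X)\<^sup>2"
    by (rule latala_oleszkiewicz[OF fin nonneg even flips])
  finally have "L2_set (\<lambda>j. L2_set (v j) A) I \<le> sqrt (2 * (avg I X)\<^sup>2)"
    unfolding L2_set_def[of _ I] by (rule real_sqrt_le_mono)
  also have "\<dots> = sqrt 2 * avg I X"
    using avg_nonneg[of I X] nonneg by (simp add: real_sqrt_mult)
  finally show ?thesis unfolding X_def .
qed

section \<open>Boxes of multi-indices\<close>

text \<open>A nested sum runs over the indices in some slots \<open>K\<close> while the indices in the outer slots keep
  the values that \<open>i\<close> prescribes. Iterated \<open>\<ell>\<^sub>2\<close>-norms are single \<open>\<ell>\<^sub>2\<close>-norms over such boxes.\<close>

definition index_box :: "nat \<Rightarrow> nat set \<Rightarrow> (nat \<Rightarrow> nat) \<Rightarrow> (nat \<Rightarrow> nat) set"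
  where "index_box n K i = {f. (\<forall>l\<in>K. f l < n) \<and> (\<forall>l. l \<notin> K \<longrightarrow> f l = i l)}"

lemma index_box_empty [simp]: "index_box n {} i = {i}"
  by (auto simp: index_box_def)

lemma index_box_insert:
  assumes "l \<notin> K"
  shows "index_box n (insert l K) i = (\<Union>j\<in>{..<n}. index_box n K (i(l := j)))"
  using assms unfolding index_box_def by (auto split: if_splits)

lemma finite_index_box: "finite K \<Longrightarrow> finite (index_box n K i)"
  by (induction K arbitrary: i rule: finite_induct) (simp_all add: index_box_insert)

lemma L2_set_index_box_insert:
  assumes "finite K" "l \<notin> K"
  shows "L2_set a (index_box n (insert l K) i) = L2_set (\<lambda>j. L2_set a (index_box n K (i(l := j)))) {..<n}"
proof -
  have "(\<Sum>f\<in>index_box n (insert l K) i. (a f)\<^sup>2) = (\<Sum>j<n. \<Sum>f\<in>index_box n K (i(l := j)). (a f)\<^sup>2)"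
    unfolding index_box_insert[OF assms(2)]
  proof (rule sum.UNION_disjoint)
    show "\<forall>j\<in>{..<n}. \<forall>j'\<in>{..<n}. j \<noteq> j' \<longrightarrow> index_box n K (i(l := j)) \<inter> index_box n K (i(l := j')) = {}"
      using assms(2) by (auto simp: index_box_def)
  qed (simp_all add: finite_index_box assms)
  then show ?thesis
    by (simp add: L2_set_def sum_nonneg)
qed

lemma L2_set_index_box_upd:
  assumes "l \<notin> K"
  shows "L2_set a (index_box n K (i(l := j))) = L2_set (\<lambda>f. a (f(l := j))) (index_box n K i)"
proof -
  have "(\<Sum>f\<in>index_box n K (i(l := j)). (a f)\<^sup>2) = (\<Sum>f\<in>index_box n K i. (a (f(l := j)))\<^sup>2)"
    by (rule sum.reindex_bij_witness[of _ "\<lambda>f. f(l := j)" "\<lambda>f. f(l := i l)"])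
       (use assms in \<open>auto simp: index_box_def fun_eq_iff fun_upd_idem\<close>)
  then show ?thesis by (simp add: L2_set_def)
qed

section \<open>Replacing slots of a multilinear form by sign vectors\<close>

text \<open>Once a slot has been filled with a fixed vector, the form is no longer linear in it. Linearity
  is therefore required only in the slots \<open>K\<close> that are still free.\<close>

definition linear_in :: "nat \<Rightarrow> nat set \<Rightarrow> ((nat \<Rightarrow> c0) \<Rightarrow> real) \<Rightarrow> bool"
  where "linear_in m K T \<longleftrightarrow> (\<forall>x\<in>tuples m. \<forall>k\<in>K. linear (\<lambda>v. T (x(k := v))))"

definition bounded_by :: "nat \<Rightarrow> real \<Rightarrow> ((nat \<Rightarrow> c0) \<Rightarrow> real) \<Rightarrow> bool"
  where "bounded_by m B T \<longleftrightarrow> (\<forall>x\<in>{1..m} \<rightarrow>\<^sub>E cball 0 1. \<bar>T x\<bar> \<le> B)"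

definition basis_tuple :: "nat \<Rightarrow> (nat \<Rightarrow> nat) \<Rightarrow> nat \<Rightarrow> c0"
  where "basis_tuple m i = (\<lambda>k\<in>{1..m}. c0_basis (i k))"

lemma coefficient_eq: "coefficient m T i = T (basis_tuple m i)"
  by (simp add: coefficient_def basis_tuple_def)

lemma basis_tuple_upd: "l \<in> {1..m} \<Longrightarrow> basis_tuple m (i(l := j)) = (basis_tuple m i)(l := c0_basis j)"
  by (auto simp: basis_tuple_def fun_eq_iff)

lemma tuples_upd: "x \<in> tuples m \<Longrightarrow> l \<in> {1..m} \<Longrightarrow> x(l := v) \<in> tuples m"
  by (auto simp: tuples_def PiE_def extensional_def)

lemma ball_upd:
  "x \<in> {1..m} \<rightarrow>\<^sub>E cball 0 1 \<Longrightarrow> l \<in> {1..m} \<Longrightarrow> norm v \<le> 1 \<Longrightarrow> x(l := v) \<in> {1..m} \<rightarrow>\<^sub>E cball (0::c0) 1"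
  by (auto simp: PiE_def extensional_def Pi_def)

lemma basis_tuple_in_tuples: "basis_tuple m i \<in> tuples m"
  by (auto simp: basis_tuple_def tuples_def)

lemma norm_c0_basis: "norm (c0_basis j) \<le> 1"
  by (rule c0_norm_le) (simp add: c0_basis.rep_eq)

lemma basis_tuple_in_ball: "basis_tuple m i \<in> {1..m} \<rightarrow>\<^sub>E cball 0 1"
  by (auto simp: basis_tuple_def norm_c0_basis)

definition sign_vec :: "nat \<Rightarrow> nat set \<Rightarrow> c0"
  where "sign_vec n S = signed_sum {..<n} S c0_basis"

lemma c0_nth_sum: "c0_nth (\<Sum>j\<in>J. v j) p = (\<Sum>j\<in>J. c0_nth (v j) p)"
  by (induction J rule: infinite_finite_induct) (simp_all add: zero_c0.rep_eq plus_c0.rep_eq)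

lemma norm_sign_vec: "norm (sign_vec n S) \<le> 1"
proof (rule c0_norm_le)
  fix p
  have "c0_nth (sign_vec n S) p = (\<Sum>j<n. (if p = j then (if j \<in> S then -1 else 1) else 0))"
    unfolding sign_vec_def signed_sum_def c0_nth_sum
    by (intro sum.cong) (simp_all add: scaleR_c0.rep_eq c0_basis.rep_eq)
  then show "\<bar>c0_nth (sign_vec n S) p\<bar> \<le> 1" by simp
qed

lemma linear_signed_sum:
  fixes g :: "'a::real_vector \<Rightarrow> real"
  assumes "linear g"
  shows "g (signed_sum I S v) = signed_sum I S (\<lambda>j. g (v j))"
  by (simp add: signed_sum_def linear_sum[OF assms] linear_scale[OF assms])

definition fix_slot :: "((nat \<Rightarrow> c0) \<Rightarrow> real) \<Rightarrow> nat \<Rightarrow> c0 \<Rightarrow> (nat \<Rightarrow> c0) \<Rightarrow> real"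
  where "fix_slot T l v x = T (x(l := v))"

lemma signed_sum_coefficient:
  assumes "linear_in m K T" "l \<in> K" "l \<in> {1..m}"
  shows "signed_sum {..<n} S (\<lambda>j. coefficient m T (f(l := j))) = coefficient m (fix_slot T l (sign_vec n S)) f"
proof -
  have "linear (\<lambda>v. T ((basis_tuple m f)(l := v)))"
    using assms basis_tuple_in_tuples by (auto simp: linear_in_def)
  from linear_signed_sum[OF this, of "{..<n}" S c0_basis] show ?thesis
    by (simp add: coefficient_eq fix_slot_def basis_tuple_upd[OF assms(3)] sign_vec_def)
qed

lemma coefficient_fix_slot_upd:
  "l \<in> {1..m} \<Longrightarrow> coefficient m (fix_slot T l v) (f(l := j)) = coefficient m (fix_slot T l v) f"
  by (simp add: coefficient_eq fix_slot_def basis_tuple_upd)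

lemma linear_in_fix_slot:
  assumes "linear_in m (insert l K) T" "l \<notin> K" "l \<in> {1..m}"
  shows "linear_in m K (fix_slot T l v)"
  unfolding linear_in_def
proof (intro ballI)
  fix x :: "nat \<Rightarrow> c0" and k assume "x \<in> tuples m" "k \<in> K"
  then have "linear (\<lambda>w. T ((x(l := v))(k := w)))"
    using assms(1) tuples_upd[OF \<open>x \<in> tuples m\<close> assms(3), of v] unfolding linear_in_def by blast
  moreover have "x(k := w, l := v) = x(l := v, k := w)" for w
    using \<open>k \<in> K\<close> assms(2) by (auto simp: fun_upd_twist)
  ultimately show "linear (\<lambda>w. fix_slot T l v (x(k := w)))"
    unfolding fix_slot_def by simp
qed

lemma bounded_by_fix_slot:
  "bounded_by m B T \<Longrightarrow> l \<in> {1..m} \<Longrightarrow> norm v \<le> 1 \<Longrightarrow> bounded_by m B (fix_slot T l v)"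
  unfolding bounded_by_def fix_slot_def using ball_upd by blast

text \<open>With the signs of the coefficients in slot \<open>k\<close>, linearity turns the sum into one value of \<open>T\<close>.\<close>

lemma sum_abs_coefficient_le:
  assumes "linear_in m {k} T" "k \<in> {1..m}" "bounded_by m B T"
  shows "(\<Sum>j<n. \<bar>coefficient m T (i(k := j))\<bar>) \<le> B"
proof -
  let ?S = "{j. coefficient m T (i(k := j)) < 0}"
  have "(\<Sum>j<n. \<bar>coefficient m T (i(k := j))\<bar>)
      = signed_sum {..<n} ?S (\<lambda>j. coefficient m T (i(k := j)))"
    unfolding signed_sum_def by (intro sum.cong) auto
  also have "\<dots> = fix_slot T k (sign_vec n ?S) (basis_tuple m i)"
    using signed_sum_coefficient[OF assms(1) _ assms(2)] by (simp add: coefficient_eq)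
  also have "\<dots> \<le> B"
    using bounded_by_fix_slot[OF assms(3,2) norm_sign_vec] basis_tuple_in_ball
    by (force simp: bounded_by_def abs_le_iff)
  finally show ?thesis .
qed

text \<open>Induction on the set of slots over which the \<open>\<ell>\<^sub>2\<close>-norm is taken. Khinchine's inequality in slot
  \<open>l\<close> bounds the norm by \<open>\<surd>2\<close> times its average over the forms obtained by putting sign vectors into
  slot \<open>l\<close>; these forms satisfy the same bound \<open>B\<close> and have one slot less to treat.\<close>

lemma sum_L2_set_coefficient_le:
  assumes "finite K" "k \<notin> K" "insert k K \<subseteq> {1..m}"
    and "linear_in m (insert k K) T" "bounded_by m B T"
  shows "(\<Sum>j<n. L2_set (coefficient m T) (index_box n K (i(k := j)))) \<le> sqrt 2 ^ card K * B"
  using assms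
proof (induction K arbitrary: T rule: finite_induct)
  case empty
  then show ?case using sum_abs_coefficient_le[of m k T B i n] by (simp add: fun_upd_def)
next
  case (insert l K)
  have l: "l \<in> {1..m}" "l \<noteq> k" "l \<notin> K" using insert.prems insert.hyps by auto
  let ?T = "\<lambda>S. fix_slot T l (sign_vec n S)"
  have IH: "(\<Sum>j<n. L2_set (coefficient m (?T S)) (index_box n K (i(k := j)))) \<le> sqrt 2 ^ card K * B" for S
  proof (rule insert.IH)
    show "linear_in m (insert k K) (?T S)"
      using insert.prems l by (intro linear_in_fix_slot) (simp_all add: insert_commute)
  qed (use insert.prems l in \<open>auto intro: bounded_by_fix_slot norm_sign_vec\<close>)
  have "(\<Sum>j<n. L2_set (coefficient m T) (index_box n (insert l K) (i(k := j))))
      \<le> (\<Sum>j<n. sqrt 2 * avg {..<n} (\<lambda>S. L2_set (coefficient m (?T S)) (index_box n K (i(k := j)))))"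
  proof (rule sum_mono)
    fix j
    have "L2_set (coefficient m T) (index_box n (insert l K) (i(k := j)))
        = L2_set (\<lambda>p. L2_set (\<lambda>f. coefficient m T (f(l := p))) (index_box n K (i(k := j)))) {..<n}"
      by (simp add: L2_set_index_box_insert[OF insert.hyps] L2_set_index_box_upd[OF l(3)])
    also have "\<dots> \<le> sqrt 2 * avg {..<n} (\<lambda>S. L2_set (\<lambda>f. signed_sum {..<n} S
        (\<lambda>p. coefficient m T (f(l := p)))) (index_box n K (i(k := j))))"
      by (rule vector_khinchine) simp
    finally show "L2_set (coefficient m T) (index_box n (insert l K) (i(k := j)))
      \<le> sqrt 2 * avg {..<n} (\<lambda>S. L2_set (coefficient m (?T S)) (index_box n K (i(k := j))))"
      using signed_sum_coefficient[OF insert.prems(3) _ l(1)] by simp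
  qed
  also have "\<dots> = sqrt 2 * avg {..<n} (\<lambda>S. \<Sum>j<n. L2_set (coefficient m (?T S)) (index_box n K (i(k := j))))"
    by (simp add: sum_distrib_left avg_sum)
  also have "\<dots> \<le> sqrt 2 * avg {..<n} (\<lambda>S. sqrt 2 ^ card K * B)"
    by (intro mult_left_mono avg_mono IH) simp
  finally show ?case using insert.hyps by (simp add: avg_const mult.assoc fun_upd_def)
qed

text \<open>The other indices of the selected coefficients may depend on \<open>j\<close>. Replacing a slot by sign
  vectors makes the coefficients independent of the index in that slot and does not decrease
  the sum on average; when all slots but \<open>k\<close> have been replaced, the choice no longer matters.\<close>

lemma sum_abs_chosen_coefficient_le:
  assumes "finite K" "k \<notin> K" "insert k K \<subseteq> {1..m}"
    and "linear_in m (insert k K) T" "bounded_by m B T"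
    and "\<And>j. j < n \<Longrightarrow> r j \<in> index_box n K (i(k := j))"
  shows "(\<Sum>j<n. \<bar>coefficient m T (r j)\<bar>) \<le> B"
  using assms
proof (induction K arbitrary: T r rule: finite_induct)
  case empty
  have "(\<Sum>j<n. \<bar>coefficient m T (r j)\<bar>) = (\<Sum>j<n. \<bar>coefficient m T (i(k := j))\<bar>)"
    using empty.prems by (intro sum.cong) (auto simp: fun_upd_def)
  then show ?case using empty.prems sum_abs_coefficient_le[of m k T B i n] by simp
next
  case (insert l K)
  have l: "l \<in> {1..m}" "l \<noteq> k" "l \<notin> K" using insert.prems insert.hyps by auto
  let ?T = "\<lambda>S. fix_slot T l (sign_vec n S)"
  have IH: "(\<Sum>j<n. \<bar>coefficient m (?T S) ((r j)(l := i l))\<bar>) \<le> B" for S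
  proof (rule insert.IH)
    show "linear_in m (insert k K) (?T S)"
      using insert.prems l by (intro linear_in_fix_slot) (simp_all add: insert_commute)
    show "(r j)(l := i l) \<in> index_box n K (i(k := j))" if "j < n" for j
      using insert.prems(5)[OF that] l by (auto simp: index_box_def)
  qed (use insert.prems l in \<open>auto intro: bounded_by_fix_slot norm_sign_vec\<close>)
  \<comment> \<open>The new form ignores slot \<open>l\<close>, so its index there may be reset to \<open>i l\<close>; this puts the
    multi-index into the smaller box.\<close>
  have "(\<Sum>j<n. \<bar>coefficient m T (r j)\<bar>)
      \<le> (\<Sum>j<n. avg {..<n} (\<lambda>S. \<bar>coefficient m (?T S) ((r j)(l := i l))\<bar>))"
  proof (rule sum_mono)
    fix j assume "j \<in> {..<n}"
    then have "r j l < n" using insert.prems(5)[of j] by (auto simp: index_box_def)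
    then have "\<bar>coefficient m T ((r j)(l := r j l))\<bar>
        \<le> avg {..<n} (\<lambda>S. \<bar>signed_sum {..<n} S (\<lambda>p. coefficient m T ((r j)(l := p)))\<bar>)"
      by (intro abs_le_avg_signed_sum) auto
    then show "\<bar>coefficient m T (r j)\<bar>
        \<le> avg {..<n} (\<lambda>S. \<bar>coefficient m (?T S) ((r j)(l := i l))\<bar>)"
      using signed_sum_coefficient[OF insert.prems(3) _ l(1)] l(1)
      by (simp add: coefficient_fix_slot_upd)
  qed
  also have "\<dots> = avg {..<n} (\<lambda>S. \<Sum>j<n. \<bar>coefficient m (?T S) ((r j)(l := i l))\<bar>)"
    by (simp add: avg_sum)
  also have "\<dots> \<le> avg {..<n} (\<lambda>S. B)"
    by (intro avg_mono IH)
  finally show ?case by (simp add: avg_const)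
qed

lemma L2_set_le_sqrt_card_support:
  assumes "finite F" "r \<in> F" "\<And>f. f \<in> F \<Longrightarrow> \<bar>a f\<bar> \<le> \<bar>a r\<bar>"
  shows "L2_set a F \<le> sqrt (card {f\<in>F. a f \<noteq> 0}) * \<bar>a r :: real\<bar>"
proof -
  have "(\<Sum>f\<in>F. (a f)\<^sup>2) = (\<Sum>f\<in>{f\<in>F. a f \<noteq> 0}. (a f)\<^sup>2)"
    using assms(1) by (intro sum.mono_neutral_right) auto
  also have "\<dots> \<le> (\<Sum>f\<in>{f\<in>F. a f \<noteq> 0}. (a r)\<^sup>2)"
    using assms(3) by (intro sum_mono) (simp add: abs_le_square_iff)
  finally have "L2_set a F \<le> sqrt (card {f\<in>F. a f \<noteq> 0} * (a r)\<^sup>2)"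
    unfolding L2_set_def by (intro real_sqrt_le_mono) simp
  then show ?thesis by (simp add: real_sqrt_mult)
qed

text \<open>For each \<open>j\<close> let \<open>r j\<close> be the position of a largest coefficient; the \<open>\<ell>\<^sub>2\<close>-norm is at most that
  coefficient times the square root of the number of nonzero ones.\<close>

lemma sum_L2_set_coefficient_le_support:
  assumes K: "finite K" "k \<notin> K" "insert k K \<subseteq> {1..m}"
    and T: "linear_in m (insert k K) T" "bounded_by m B T"
    and A: "finite A" "\<And>j f. f \<in> index_box n K (i(k := j)) \<Longrightarrow> coefficient m T f \<noteq> 0 \<Longrightarrow> f \<in> A"
  shows "(\<Sum>j<n. L2_set (coefficient m T) (index_box n K (i(k := j)))) \<le> sqrt (card A) * B"
proof -
  let ?a = "coefficient m T"
  have ex: "\<exists>r\<in>index_box n K (i(k := j)). \<forall>f\<in>index_box n K (i(k := j)). \<bar>?a f\<bar> \<le> \<bar>?a r\<bar>" if "j < n" for j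
  proof -
    have "(\<lambda>l. if l \<in> K then 0 else (i(k := j)) l) \<in> index_box n K (i(k := j))"
      using that by (auto simp: index_box_def)
    then have ne: "(\<lambda>f. \<bar>?a f\<bar>) ` index_box n K (i(k := j)) \<noteq> {}" by blast
    have fin: "finite ((\<lambda>f. \<bar>?a f\<bar>) ` index_box n K (i(k := j)))"
      using finite_index_box[OF K(1)] by blast
    from Max_in[OF fin ne] Max_ge[OF fin] show ?thesis by (metis (no_types, lifting) imageE imageI)
  qed
  then obtain r where r: "\<And>j. j < n \<Longrightarrow> r j \<in> index_box n K (i(k := j))"
    and max: "\<And>j f. j < n \<Longrightarrow> f \<in> index_box n K (i(k := j)) \<Longrightarrow> \<bar>?a f\<bar> \<le> \<bar>?a (r j)\<bar>"
    by metis
  have "(\<Sum>j<n. L2_set ?a (index_box n K (i(k := j)))) \<le> (\<Sum>j<n. sqrt (card A) * \<bar>?a (r j)\<bar>)"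
  proof (rule sum_mono)
    fix j assume "j \<in> {..<n}"
    then have "L2_set ?a (index_box n K (i(k := j)))
        \<le> sqrt (card {f \<in> index_box n K (i(k := j)). ?a f \<noteq> 0}) * \<bar>?a (r j)\<bar>"
      by (intro L2_set_le_sqrt_card_support finite_index_box K(1) r max) auto
    also have "\<dots> \<le> sqrt (card A) * \<bar>?a (r j)\<bar>"
      using A by (intro mult_right_mono real_sqrt_le_mono) (auto intro!: card_mono)
    finally show "L2_set ?a (index_box n K (i(k := j))) \<le> sqrt (card A) * \<bar>?a (r j)\<bar>" .
  qed
  also have "\<dots> = sqrt (card A) * (\<Sum>j<n. \<bar>?a (r j)\<bar>)"
    by (simp add: sum_distrib_left)
  also have "\<dots> \<le> sqrt (card A) * B"
    using sum_abs_chosen_coefficient_le[OF K T r] by (intro mult_left_mono) auto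
  finally show ?thesis .
qed

section \<open>Truncated mixed norms\<close>

text \<open>Unlike in \<open>nested_sum\<close>, the root is extracted
  at every level, so that each level is the norm of the function of the next index.\<close>

fun trunc_norm :: "nat \<Rightarrow> (nat \<Rightarrow> real) \<Rightarrow> ((nat \<Rightarrow> nat) \<Rightarrow> real) \<Rightarrow> nat list \<Rightarrow> (nat \<Rightarrow> nat) \<Rightarrow> real"
  where
    "trunc_norm n q a [] i = \<bar>a i\<bar>"
  | "trunc_norm n q a (k # ks) i =
       (\<Sum>j<n. trunc_norm n q a ks (i(k := j)) powr q k) powr (1 / q k)"

lemma trunc_norm_nonneg: "0 \<le> trunc_norm n q a ks i"
  by (cases ks) auto

lemma trunc_norm_Cons_2:
  "q k = 2 \<Longrightarrow> trunc_norm n q a (k # ks) i = L2_set (\<lambda>j. trunc_norm n q a ks (i(k := j))) {..<n}"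
  by (simp add: L2_set_def powr_half_sqrt sum_nonneg trunc_norm_nonneg)

lemma trunc_norm_Cons_1:
  "q k = 1 \<Longrightarrow> trunc_norm n q a (k # ks) i = (\<Sum>j<n. trunc_norm n q a ks (i(k := j)))"
  by (simp add: sum_nonneg trunc_norm_nonneg)

lemma trunc_norm_all_2:
  assumes "distinct ks" "\<forall>l\<in>set ks. q l = 2"
  shows "trunc_norm n q a ks i = L2_set a (index_box n (set ks) i)"
  using assms
proof (induction ks arbitrary: i)
  case (Cons k ks)
  then show ?case
    by (simp add: trunc_norm_Cons_2 L2_set_index_box_insert del: trunc_norm.simps)
qed simp

text \<open>Minkowski's inequality, applied once for each slot in \<open>pre\<close>, moves the \<open>\<ell>\<^sub>1\<close>-norm in slot \<open>k\<close> to
  the outermost position.\<close>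

lemma trunc_norm_le_sum_L2_set:
  assumes "distinct (pre @ k # post)" "q k = 1" "\<forall>l\<in>set pre \<union> set post. q l = 2"
  shows "trunc_norm n q a (pre @ k # post) i
    \<le> (\<Sum>j<n. L2_set a (index_box n (set pre \<union> set post) (i(k := j))))"
  using assms
proof (induction pre arbitrary: i)
  case Nil
  then show ?case
    by (simp add: trunc_norm_Cons_1 trunc_norm_all_2 fun_upd_def del: trunc_norm.simps)
next
  case (Cons p pre)
  let ?K = "set pre \<union> set post"
  have p: "p \<noteq> k" "p \<notin> ?K" using Cons.prems by auto
  have "trunc_norm n q a ((p # pre) @ k # post) i
      = L2_set (\<lambda>j. trunc_norm n q a (pre @ k # post) (i(p := j))) {..<n}"
    using Cons.prems by (simp add: trunc_norm_Cons_2 del: trunc_norm.simps)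
  also have "\<dots> \<le> L2_set (\<lambda>j. \<Sum>j'<n. L2_set a (index_box n ?K (i(p := j, k := j')))) {..<n}"
    using Cons.prems by (intro L2_set_mono trunc_norm_nonneg Cons.IH) auto
  also have "\<dots> \<le> (\<Sum>j'<n. L2_set (\<lambda>j. L2_set a (index_box n ?K (i(p := j, k := j')))) {..<n})"
    by (rule L2_set_sum_le) simp
  also have "\<dots> = (\<Sum>j'<n. L2_set a (index_box n (insert p ?K) (i(k := j'))))"
    using p by (simp add: L2_set_index_box_insert fun_upd_twist)
  finally show ?case by (simp add: fun_upd_def)
qed

lemma trunc_norm_one_two_le:
  assumes "k \<in> {1..m}"
  shows "trunc_norm n (one_two_tuple k) a [1..<Suc m] i
    \<le> (\<Sum>j<n. L2_set a (index_box n ({1..m} - {k}) (i(k := j))))"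
proof -
  have "[1..<Suc m] = [1..<k] @ k # [Suc k..<Suc m]"
    using assms upt_add_eq_append[of 1 k "Suc m - k"] by (simp add: upt_conv_Cons)
  moreover have "set [1..<k] \<union> set [Suc k..<Suc m] = {1..m} - {k}" using assms by auto
  ultimately show ?thesis
    using trunc_norm_le_sum_L2_set[of "[1..<k]" k "[Suc k..<Suc m]" "one_two_tuple k" n a i]
    by (simp add: one_two_tuple_def del: upt_Suc)
qed

text \<open>If all coefficients on a product of intervals have modulus at least 1, the mixed norm dominates
  that of the indicator function of the product, which factors over the slots.\<close>

lemma trunc_norm_ge:
  assumes "\<And>k. k \<in> set ks \<Longrightarrow> 0 < q k \<and> N k \<le> n"
    and "\<And>f. (\<And>k. k \<in> set ks \<Longrightarrow> f k < N k) \<Longrightarrow> (\<And>k. k \<notin> set ks \<Longrightarrow> f k = i k) \<Longrightarrow> 1 \<le> \<bar>a f\<bar>"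
    and "distinct ks"
  shows "(\<Prod>k\<in>set ks. real (N k) powr (1 / q k)) \<le> trunc_norm n q a ks i"
  using assms
proof (induction ks arbitrary: i)
  case Nil
  then show ?case by simp
next
  case (Cons k ks)
  define c where "c = (\<Prod>k\<in>set ks. real (N k) powr (1 / q k))"
  have c: "0 \<le> c" unfolding c_def by (intro prod_nonneg) auto
  have q: "0 < q k" "N k \<le> n" using Cons.prems(1) by auto
  have IH: "c \<le> trunc_norm n q a ks (i(k := j))" if "j < N k" for j
    unfolding c_def
  proof (rule Cons.IH)
    fix f assume f: "\<And>l. l \<in> set ks \<Longrightarrow> f l < N l" "\<And>l. l \<notin> set ks \<Longrightarrow> f l = (i(k := j)) l"
    show "1 \<le> \<bar>a f\<bar>"
    proof (rule Cons.prems(2))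
      show "f l < N l" if "l \<in> set (k # ks)" for l
        using f(1)[of l] f(2)[of k] that \<open>j < N k\<close> Cons.prems(3) by auto
      show "f l = i l" if "l \<notin> set (k # ks)" for l
        using f(2)[of l] that by auto
    qed
  qed (use Cons.prems in auto)
  have "real (N k) * c powr q k = (\<Sum>j<N k. c powr q k)" by simp
  also have "\<dots> \<le> (\<Sum>j<N k. trunc_norm n q a ks (i(k := j)) powr q k)"
    using c q IH by (intro sum_mono powr_mono2) auto
  also have "\<dots> \<le> (\<Sum>j<n. trunc_norm n q a ks (i(k := j)) powr q k)"
    using q by (intro sum_mono2) auto
  finally have "(real (N k) * c powr q k) powr (1 / q k) \<le> trunc_norm n q a (k # ks) i"
    using q c by (simp add: powr_mono2)
  moreover have "(real (N k) * c powr q k) powr (1 / q k) = real (N k) powr (1 / q k) * c"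
    using q c by (simp add: powr_mult powr_powr)
  ultimately show ?case using Cons.prems(3) by (simp add: c_def)
qed

section \<open>Mixed norms as suprema of truncated norms\<close>

lemma epowr_ennreal: "0 \<le> r \<Longrightarrow> ennreal r epowr p = ennreal (r powr p)"
  by (simp add: epowr_def)

lemma epowr_mono: "0 \<le> p \<Longrightarrow> x \<le> y \<Longrightarrow> x epowr p \<le> y epowr p"
  by (auto simp: epowr_def top_unique less_top intro!: ennreal_leI powr_mono2 enn2real_mono)

lemma epowr_epowr: "(x epowr p) epowr r = x epowr (p * r)"
  by (simp add: epowr_def powr_powr)

lemma epowr_one: "x epowr 1 = x"
  by (cases x) (auto simp: epowr_def)

lemma epowr_inverse: "0 < p \<Longrightarrow> (x epowr p) epowr (1 / p) = x" "0 < p \<Longrightarrow> (x epowr (1 / p)) epowr p = x"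
  by (simp_all add: epowr_epowr epowr_one)

text \<open>A power with a positive exponent is an order automorphism of \<open>[0,\<infinity>]\<close>, whose inverse is the power
  with the reciprocal exponent.\<close>

lemma epowr_SUP:
  fixes f :: "nat \<Rightarrow> ennreal"
  assumes "0 < p"
  shows "(SUP n. f n) epowr p = (SUP n. f n epowr p)"
proof (rule antisym)
  have "f n \<le> (SUP n. f n epowr p) epowr (1 / p)" for n
    using epowr_mono[of "1 / p" "f n epowr p" "SUP n. f n epowr p", OF _ SUP_upper] assms
    by (simp add: epowr_inverse)
  then have "(SUP n. f n) \<le> (SUP n. f n epowr p) epowr (1 / p)"
    by (rule SUP_least)
  from epowr_mono[OF _ this, of p] show "(SUP n. f n) epowr p \<le> (SUP n. f n epowr p)"
    using assms by (simp add: epowr_inverse)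
  show "(SUP n. f n epowr p) \<le> (SUP n. f n) epowr p"
    using assms by (intro SUP_least epowr_mono SUP_upper) auto
qed

fun iter_norm :: "(nat \<Rightarrow> real) \<Rightarrow> ((nat \<Rightarrow> nat) \<Rightarrow> real) \<Rightarrow> nat list \<Rightarrow> (nat \<Rightarrow> nat) \<Rightarrow> ennreal"
  where
    "iter_norm q a [] i = ennreal \<bar>a i\<bar>"
  | "iter_norm q a (k # ks) i = (\<Sum>j. iter_norm q a ks (i(k := j)) epowr q k) epowr (1 / q k)"

lemma nested_sum_Cons:
  assumes "\<forall>l\<in>set (k # ks). 0 < q l"
  shows "nested_sum q a (k # ks) i = (\<Sum>j. iter_norm q a ks (i(k := j)) epowr q k)"
  using assms
proof (induction ks arbitrary: k i)
  case (Cons l ks)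
  have "nested_sum q a (l # ks) i epowr (q k / q l) = iter_norm q a (l # ks) i epowr q k" for i
    using Cons.prems by (simp add: Cons.IH epowr_epowr fun_upd_def)
  then show ?case by (simp add: fun_upd_def)
qed simp

lemma trunc_norm_mono:
  assumes "n \<le> n'" "\<forall>l\<in>set ks. 0 < q l"
  shows "trunc_norm n q a ks i \<le> trunc_norm n' q a ks i"
  using assms(2)
proof (induction ks arbitrary: i)
  case (Cons k ks)
  have "(\<Sum>j<n. trunc_norm n q a ks (i(k := j)) powr q k)
      \<le> (\<Sum>j<n. trunc_norm n' q a ks (i(k := j)) powr q k)"
    using Cons by (intro sum_mono powr_mono2 trunc_norm_nonneg) auto
  also have "\<dots> \<le> (\<Sum>j<n'. trunc_norm n' q a ks (i(k := j)) powr q k)"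
    using assms(1) by (intro sum_mono2) auto
  finally show ?case
    using Cons.prems by (auto intro!: powr_mono2 sum_nonneg)
qed simp

text \<open>By monotonicity, two truncation parameters may be replaced by the larger one.\<close>

lemma suminf_SUP_diagonal:
  fixes h :: "nat \<Rightarrow> nat \<Rightarrow> ennreal"
  assumes "\<And>j. incseq (\<lambda>n. h n j)"
  shows "(\<Sum>j. SUP n. h n j) = (SUP n. \<Sum>j<n. h n j)"
proof -
  have "(\<Sum>j. SUP n. h n j) = (SUP n. SUP N. \<Sum>j<N. h n j)"
    unfolding ennreal_suminf_SUP_eq[OF assms] by (simp only: suminf_eq_SUP)
  also have "\<dots> = (SUP n. \<Sum>j<n. h n j)"
  proof (rule antisym)
    have "(\<Sum>j<N. h n j) \<le> (SUP n. \<Sum>j<n. h n j)" for n N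
    proof -
      have "(\<Sum>j<N. h n j) \<le> (\<Sum>j<N. h (max n N) j)"
        using assms by (intro sum_mono) (auto simp: incseq_def)
      also have "\<dots> \<le> (\<Sum>j<max n N. h (max n N) j)"
        by (intro sum_mono2) auto
      also have "\<dots> \<le> (SUP n. \<Sum>j<n. h n j)"
        by (rule SUP_upper) simp
      finally show ?thesis .
    qed
    then show "(SUP n. SUP N. \<Sum>j<N. h n j) \<le> (SUP n. \<Sum>j<n. h n j)"
      by (intro SUP_least)
    show "(SUP n. \<Sum>j<n. h n j) \<le> (SUP n. SUP N. \<Sum>j<N. h n j)"
      by (intro SUP_mono') (rule SUP_upper, simp)
  qed
  finally show ?thesis .
qed

lemma iter_norm_eq_SUP:
  assumes "\<forall>l\<in>set ks. 0 < q l"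
  shows "iter_norm q a ks i = (SUP n. ennreal (trunc_norm n q a ks i))"
  using assms
proof (induction ks arbitrary: i)
  case (Cons k ks)
  let ?h = "\<lambda>n j. ennreal (trunc_norm n q a ks (i(k := j)) powr q k)"
  have q: "0 < q k" using Cons.prems by simp
  have "(\<Sum>j. iter_norm q a ks (i(k := j)) epowr q k) = (\<Sum>j. SUP n. ?h n j)"
    using Cons q by (simp add: epowr_SUP epowr_ennreal trunc_norm_nonneg)
  also have "\<dots> = (SUP n. \<Sum>j<n. ?h n j)"
    using Cons.prems q
    by (intro suminf_SUP_diagonal)
       (auto simp: incseq_def intro!: ennreal_leI powr_mono2 trunc_norm_mono trunc_norm_nonneg)
  also have "\<dots> = (SUP n. ennreal (\<Sum>j<n. trunc_norm n q a ks (i(k := j)) powr q k))"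
    by (simp add: sum_ennreal)
  finally show ?case
    using q by (simp add: epowr_SUP epowr_ennreal sum_nonneg)
qed simp

lemma mixed_norm_eq_SUP:
  assumes "1 \<le> m" "\<And>l. 0 < q l"
  shows "mixed_norm m q T
    = (SUP n. ennreal (trunc_norm n q (coefficient m T) [1..<Suc m] (\<lambda>_. undefined)))"
proof -
  have "[1..<Suc m] = 1 # [2..<Suc m]"
    using assms(1) by (simp add: upt_conv_Cons numeral_2_eq_2)
  then have "mixed_norm m q T = iter_norm q (coefficient m T) [1..<Suc m] (\<lambda>_. undefined)"
    using assms(2) by (simp add: mixed_norm_def nested_sum_Cons)
  then show ?thesis using assms(2) by (simp add: iter_norm_eq_SUP)
qed

lemma one_two_tuple_pos: "0 < one_two_tuple k l"
  by (simp add: one_two_tuple_def)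

section \<open>Upper bounds for the mixed norm\<close>

lemma cont_multilinear_linear_in:
  "cont_multilinear_form m T \<Longrightarrow> linear_in m {1..m} T"
  by (simp add: cont_multilinear_form_def linear_in_def)

lemma bounded_by_iff: "0 \<le> B \<Longrightarrow> bounded_by m B T \<longleftrightarrow> form_norm m T \<le> ennreal B"
  by (simp add: bounded_by_def form_norm_def SUP_le_iff)

lemma mixed_norm_le:
  assumes "cont_multilinear_form m T" "k \<in> {1..m}" "bounded_by m B T"
  shows "mixed_norm m (one_two_tuple k) T \<le> ennreal (sqrt 2 ^ (m - 1) * B)"
proof -
  have m: "1 \<le> m" using assms(2) by simp
  have ins: "insert k ({1..m} - {k}) = {1..m}" using assms(2) by auto
  have "trunc_norm n (one_two_tuple k) (coefficient m T) [1..<Suc m] i \<le> sqrt 2 ^ (m - 1) * B" for n i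
    using trunc_norm_one_two_le[OF assms(2), of n "coefficient m T" i]
      sum_L2_set_coefficient_le[of "{1..m} - {k}" k m T B n i, unfolded ins,
        OF _ _ _ cont_multilinear_linear_in[OF assms(1)] assms(3)] assms(2)
    by (simp del: upt_Suc)
  then show ?thesis
    unfolding mixed_norm_eq_SUP[OF m one_two_tuple_pos] by (intro SUP_least ennreal_leI)
qed

lemma mixed_norm_le_support:
  fixes T m
  defines "A \<equiv> {i \<in> tuples m. coefficient m T i \<noteq> 0}"
  assumes "cont_multilinear_form m T" "k \<in> {1..m}" "bounded_by m B T" "finite A"
  shows "mixed_norm m (one_two_tuple k) T \<le> ennreal (sqrt (card A) * B)"
proof -
  have m: "1 \<le> m" using assms(3) by simp
  have ins: "insert k ({1..m} - {k}) = {1..m}" using assms(3) by auto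
  let ?i = "\<lambda>_. undefined :: nat"
  have "trunc_norm n (one_two_tuple k) (coefficient m T) [1..<Suc m] ?i \<le> sqrt (card A) * B" for n
  proof -
    note trunc_norm_one_two_le[OF assms(3)]
    also have "(\<Sum>j<n. L2_set (coefficient m T) (index_box n ({1..m} - {k}) (?i(k := j)))) \<le> sqrt (card A) * B"
    proof (rule sum_L2_set_coefficient_le_support)
      show "f \<in> A" if "f \<in> index_box n ({1..m} - {k}) (?i(k := j))" "coefficient m T f \<noteq> 0" for j f
        using that assms(3) by (auto simp: A_def index_box_def tuples_def PiE_def extensional_def)
    qed (use assms ins cont_multilinear_linear_in in auto)
    finally show ?thesis .
  qed
  then show ?thesis
    unfolding mixed_norm_eq_SUP[OF m one_two_tuple_pos] by (intro SUP_least ennreal_leI)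
qed

section \<open>The norm of a continuous form is finite and positive\<close>

lemma linear_in_scale:
  assumes T: "linear_in m {1..m} T" and x: "x \<in> tuples m" and A: "finite A" "A \<subseteq> {1..m}"
  shows "T (\<lambda>l. if l \<in> A then c l *\<^sub>R x l else x l) = (\<Prod>l\<in>A. c l) * T x"
  using A
proof (induction A rule: finite_induct)
  case (insert p A)
  let ?y = "\<lambda>l. if l \<in> A then c l *\<^sub>R x l else x l"
  have y: "?y \<in> tuples m"
    using x insert.prems by (auto simp: tuples_def PiE_def extensional_def)
  have lin: "linear (\<lambda>v. T (?y(p := v)))"
    using T y insert.prems unfolding linear_in_def by blast
  have "(\<lambda>l. if l \<in> insert p A then c l *\<^sub>R x l else x l) = ?y(p := c p *\<^sub>R x p)"
    by auto
  moreover have "?y(p := x p) = ?y" using insert.hyps by auto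
  ultimately show ?case
    using linear_scale[OF lin, of "c p" "x p"] insert by simp
qed simp

text \<open>Continuity at 0 gives a product of balls with radii \<open>e l\<close> on which \<open>\<bar>T\<bar> < 1\<close>. Scaling slot \<open>l\<close> by
  \<open>e l / 2\<close> moves the product of unit balls into it.\<close>

lemma form_norm_finite:
  assumes "cont_multilinear_form m T" "1 \<le> m"
  shows "form_norm m T < \<infinity>"
proof -
  let ?P = "product_topology (\<lambda>_. euclidean :: c0 topology) {1..m}"
  define z :: "nat \<Rightarrow> c0" where "z = (\<lambda>l\<in>{1..m}. 0)"
  have lin: "linear_in m {1..m} T" by (rule cont_multilinear_linear_in[OF assms(1)])
  have z: "z \<in> tuples m" by (auto simp: z_def tuples_def)
  have "T z = 0"
  proof -
    have "linear (\<lambda>v. T (z(1 := v)))" using lin z assms(2) by (auto simp: linear_in_def)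
    from linear_0[OF this] show ?thesis using assms(2) by (simp add: z_def fun_upd_idem)
  qed
  have "openin ?P {x \<in> topspace ?P. T x \<in> {-1<..<1}}"
    using assms(1) by (intro openin_continuous_map_preimage[where Y = euclideanreal])
      (auto simp: cont_multilinear_form_def)
  moreover have "z \<in> {x \<in> topspace ?P. T x \<in> {-1<..<1}}"
    using \<open>T z = 0\<close> z by (simp add: tuples_def)
  ultimately have "\<exists>U. finite {l \<in> {1..m}. U l \<noteq> topspace (euclidean :: c0 topology)} \<and>
      (\<forall>l\<in>{1..m}. openin euclidean (U l)) \<and> z \<in> Pi\<^sub>E {1..m} U \<and>
      Pi\<^sub>E {1..m} U \<subseteq> {x \<in> topspace ?P. T x \<in> {-1<..<1}}"
    unfolding openin_product_topology_alt by (rule bspec)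
  then obtain U where U: "\<forall>l\<in>{1..m}. openin euclidean (U l)" "z \<in> Pi\<^sub>E {1..m} U"
    and sub: "Pi\<^sub>E {1..m} U \<subseteq> {x \<in> topspace ?P. T x \<in> {-1<..<1}}"
    by (elim exE conjE)
  have "\<exists>e>0. ball 0 e \<subseteq> U l" if "l \<in> {1..m}" for l
  proof -
    have "0 \<in> U l" using PiE_mem[OF U(2) that] that by (simp add: z_def)
    then show ?thesis using U(1) that by (meson open_openin open_contains_ball)
  qed
  then obtain e where e: "\<And>l. l \<in> {1..m} \<Longrightarrow> 0 < e l" "\<And>l. l \<in> {1..m} \<Longrightarrow> ball 0 (e l) \<subseteq> U l"
    by metis
  have "\<bar>T x\<bar> \<le> (\<Prod>l\<in>{1..m}. 2 / e l)" if x: "x \<in> {1..m} \<rightarrow>\<^sub>E cball 0 1" for x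
  proof -
    let ?y = "\<lambda>l. if l \<in> {1..m} then (e l / 2) *\<^sub>R x l else x l"
    have "?y \<in> Pi\<^sub>E {1..m} U"
    proof (rule PiE_I)
      fix l assume l: "l \<in> {1..m}"
      have "e l / 2 * norm (x l) \<le> e l / 2 * 1"
        using x l e(1)[OF l] by (intro mult_left_mono) auto
      then show "?y l \<in> U l"
        using l e(1)[OF l] e(2)[OF l] by (force simp: subset_iff)
    next
      fix l assume "l \<notin> {1..m}"
      then show "?y l = undefined" using x by (auto simp: PiE_def extensional_def)
    qed
    then have "\<bar>T ?y\<bar> \<le> 1" using sub by force
    moreover have "T ?y = (\<Prod>l\<in>{1..m}. e l / 2) * T x"
      using x by (intro linear_in_scale[OF lin]) (auto simp: tuples_def PiE_def extensional_def)
    moreover have pos: "0 < (\<Prod>l\<in>{1..m}. e l / 2)" using e(1) by (intro prod_pos) auto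
    ultimately have "\<bar>T x\<bar> \<le> 1 / (\<Prod>l\<in>{1..m}. e l / 2)"
      by (simp add: abs_mult field_simps)
    also have "\<dots> = (\<Prod>l\<in>{1..m}. 2 / e l)"
      by (simp add: prod_dividef)
    finally show ?thesis .
  qed
  then have "form_norm m T \<le> ennreal (\<Prod>l\<in>{1..m}. 2 / e l)"
    unfolding form_norm_def by (intro SUP_least ennreal_leI)
  then show ?thesis by (rule le_less_trans) simp
qed

text \<open>Normalising each entry moves any tuple into the product of the unit balls.\<close>

lemma form_norm_pos:
  assumes "linear_in m {1..m} T" "x \<in> tuples m" "T x \<noteq> 0"
  shows "0 < form_norm m T"
proof (rule ccontr)
  assume "\<not> 0 < form_norm m T"
  then have 0: "bounded_by m 0 T" by (simp add: bounded_by_iff)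
  let ?y = "\<lambda>l\<in>{1..m}. sgn (x l)"
  have y: "?y \<in> {1..m} \<rightarrow>\<^sub>E cball 0 1" by (auto simp: norm_sgn)
  have "(\<lambda>l. if l \<in> {1..m} then norm (x l) *\<^sub>R ?y l else ?y l) = x"
  proof
    fix l
    show "(if l \<in> {1..m} then norm (x l) *\<^sub>R ?y l else ?y l) = x l"
      using assms(2) by (cases "x l = 0") (auto simp: tuples_def PiE_def extensional_def sgn_div_norm)
  qed
  then have "T x = (\<Prod>l\<in>{1..m}. norm (x l)) * T ?y"
    using linear_in_scale[OF assms(1), of ?y "{1..m}" "\<lambda>l. norm (x l)"] by (simp add: tuples_def)
  moreover have "T ?y = 0" using 0 y by (force simp: bounded_by_def)
  ultimately show False using assms(3) by simp
qed

section \<open>An extremal form\<close>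

text \<open>The subsets \<open>S\<close> of the slots other than \<open>k\<close> are the sign patterns on these slots; \<open>e\<close> will be an
  enumeration of the patterns by the coordinates below \<open>2\<^sup>m\<^sup>-\<^sup>1\<close> of slot \<open>k\<close>. For \<open>m = 2\<close>, with
  \<open>x\<close> in slot \<open>k\<close>, the form is \<open>x\<^sub>0(y\<^sub>0 + y\<^sub>1) + x\<^sub>1(y\<^sub>0 - y\<^sub>1)\<close> or \<open>x\<^sub>1(y\<^sub>0 + y\<^sub>1) + x\<^sub>0(y\<^sub>0 - y\<^sub>1)\<close>.\<close>

definition sign_form :: "nat \<Rightarrow> nat \<Rightarrow> (nat set \<Rightarrow> nat) \<Rightarrow> (nat \<Rightarrow> c0) \<Rightarrow> real"
  where "sign_form m k e x = (\<Sum>S\<in>Pow ({1..m} - {k}). c0_nth (x k) (e S) *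
    (\<Prod>l\<in>{1..m} - {k}. c0_nth (x l) 0 + (if l \<in> S then -1 else 1) * c0_nth (x l) 1))"

lemma linear_c0_nth: "linear (\<lambda>v. c0_nth v n)"
  by (rule linearI) (simp_all add: plus_c0.rep_eq scaleR_c0.rep_eq)

lemma continuous_map_c0_nth:
  assumes "l \<in> I"
  shows "continuous_map (product_topology (\<lambda>_. euclidean) I) euclideanreal (\<lambda>x. c0_nth (x l) n)"
proof -
  have "bounded_linear (\<lambda>v. c0_nth v n)"
    using linear_c0_nth[of n] c0_nth_le_norm[of _ n]
    by (intro bounded_linear_intro[where K = 1]) (auto simp: linear_iff)
  then have "continuous_map euclidean euclideanreal (\<lambda>v. c0_nth v n)"
    by (simp add: linear_continuous_on)
  from continuous_map_compose[OF continuous_map_product_projection[OF assms] this] show ?thesis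
    by (simp add: o_def)
qed

lemma sign_form_cont_multilinear:
  assumes "k \<in> {1..m}"
  shows "cont_multilinear_form m (sign_form m k e)"
  unfolding cont_multilinear_form_def
proof (intro conjI ballI)
  let ?K = "{1..m} - {k}"
  let ?f = "\<lambda>S l v. c0_nth v 0 + (if l \<in> S then -1 else 1) * c0_nth v 1"
  fix x :: "nat \<Rightarrow> c0" and p assume p: "p \<in> {1..m}"
  have "linear (\<lambda>v. c0_nth ((x(p := v)) k) (e S) * (\<Prod>l\<in>?K. ?f S l ((x(p := v)) l)))" for S
  proof (cases "p = k")
    case True
    then have "(\<Prod>l\<in>?K. ?f S l ((x(p := v)) l)) = (\<Prod>l\<in>?K. ?f S l (x l))" for v
      by (intro prod.cong) auto
    then show ?thesis
      using True by (intro linearI) (simp_all add: plus_c0.rep_eq scaleR_c0.rep_eq algebra_simps)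
  next
    case False
    have "(\<Prod>l\<in>?K. ?f S l ((x(p := v)) l)) = ?f S p v * (\<Prod>l\<in>?K - {p}. ?f S l (x l))" for v
    proof -
      have "(\<Prod>l\<in>?K - {p}. ?f S l ((x(p := v)) l)) = (\<Prod>l\<in>?K - {p}. ?f S l (x l))"
        by (intro prod.cong) auto
      then show ?thesis
        using p False by (subst prod.remove[of _ p]) auto
    qed
    then show ?thesis
      using False by (intro linearI) (simp_all add: plus_c0.rep_eq scaleR_c0.rep_eq algebra_simps)
  qed
  then show "linear (\<lambda>v. sign_form m k e (x(p := v)))"
    unfolding sign_form_def by (intro linear_compose_sum) blast
next
  show "continuous_map (product_topology (\<lambda>_. euclidean) {1..m}) euclideanreal (sign_form m k e)"
    unfolding sign_form_def using assms
    by (intro continuous_map_sum continuous_map_real_mult continuous_map_prod continuous_map_add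
        continuous_map_c0_nth) auto
qed

text \<open>Dropping the coordinates in slot \<open>k\<close>, which are at most 1 in modulus, leaves the sum over all
  patterns of products of \<open>\<bar>x\<^sub>0 - x\<^sub>1\<bar>\<close> and \<open>\<bar>x\<^sub>0 + x\<^sub>1\<bar>\<close>. This is the expansion of the product over the
  slots of \<open>\<bar>x\<^sub>0 - x\<^sub>1\<bar> + \<bar>x\<^sub>0 + x\<^sub>1\<bar>\<close>, and each of these factors is at most 2.\<close>

lemma bounded_by_sign_form:
  assumes "k \<in> {1..m}"
  shows "bounded_by m (2 ^ (m - 1)) (sign_form m k e)"
  unfolding bounded_by_def
proof
  fix x :: "nat \<Rightarrow> c0" assume x: "x \<in> {1..m} \<rightarrow>\<^sub>E cball 0 1"
  let ?K = "{1..m} - {k}"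
  have le: "\<bar>c0_nth (x l) n\<bar> \<le> 1" if "l \<in> {1..m}" for l n
  proof -
    have "norm (x l) \<le> 1" using PiE_mem[OF x that] by simp
    then show ?thesis using c0_nth_le_norm[of "x l" n] by linarith
  qed
  have "\<bar>sign_form m k e x\<bar> \<le> (\<Sum>S\<in>Pow ?K. \<Prod>l\<in>?K.
      \<bar>c0_nth (x l) 0 + (if l \<in> S then -1 else 1) * c0_nth (x l) 1\<bar>)"
    unfolding sign_form_def
  proof (rule order_trans[OF sum_abs sum_mono])
    fix S
    have "\<bar>c0_nth (x k) (e S)\<bar> * c \<le> c" if "0 \<le> c" for c
      using le[OF assms] that by (simp add: mult_left_le_one_le)
    then show "\<bar>c0_nth (x k) (e S) * (\<Prod>l\<in>?K. c0_nth (x l) 0 + (if l \<in> S then -1 else 1) * c0_nth (x l) 1)\<bar>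
        \<le> (\<Prod>l\<in>?K. \<bar>c0_nth (x l) 0 + (if l \<in> S then -1 else 1) * c0_nth (x l) 1\<bar>)"
      unfolding abs_mult abs_prod by (simp add: prod_nonneg)
  qed
  also have "\<dots> = (\<Sum>S\<in>Pow ?K. (\<Prod>l\<in>S. \<bar>c0_nth (x l) 0 - c0_nth (x l) 1\<bar>)
      * (\<Prod>l\<in>?K - S. \<bar>c0_nth (x l) 0 + c0_nth (x l) 1\<bar>))"
  proof (rule sum.cong)
    fix S assume "S \<in> Pow ?K"
    then have S: "S \<subseteq> ?K" by simp
    let ?g = "\<lambda>l. \<bar>c0_nth (x l) 0 + (if l \<in> S then -1 else 1) * c0_nth (x l) 1\<bar>"
    have "prod ?g ?K = prod ?g (?K - S) * prod ?g S"
      by (rule prod.subset_diff[OF S]) simp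
    also have "prod ?g S = (\<Prod>l\<in>S. \<bar>c0_nth (x l) 0 - c0_nth (x l) 1\<bar>)"
      by (rule prod.cong) auto
    also have "prod ?g (?K - S) = (\<Prod>l\<in>?K - S. \<bar>c0_nth (x l) 0 + c0_nth (x l) 1\<bar>)"
      by (rule prod.cong) auto
    finally show "prod ?g ?K = (\<Prod>l\<in>S. \<bar>c0_nth (x l) 0 - c0_nth (x l) 1\<bar>)
      * (\<Prod>l\<in>?K - S. \<bar>c0_nth (x l) 0 + c0_nth (x l) 1\<bar>)" by simp
  qed simp
  also have "\<dots> = (\<Prod>l\<in>?K. \<bar>c0_nth (x l) 0 - c0_nth (x l) 1\<bar> + \<bar>c0_nth (x l) 0 + c0_nth (x l) 1\<bar>)"
    by (rule prod_add[symmetric]) simp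
  also have "\<dots> \<le> (\<Prod>l\<in>?K. 2)"
  proof (intro prod_mono conjI)
    fix l assume "l \<in> ?K"
    then have "\<bar>c0_nth (x l) 0\<bar> \<le> 1" "\<bar>c0_nth (x l) 1\<bar> \<le> 1" using le by auto
    then show "\<bar>c0_nth (x l) 0 - c0_nth (x l) 1\<bar> + \<bar>c0_nth (x l) 0 + c0_nth (x l) 1\<bar> \<le> 2"
      by linarith
  qed simp
  finally show "\<bar>sign_form m k e x\<bar> \<le> 2 ^ (m - 1)" using assms by simp
qed

lemma coefficient_sign_form:
  assumes "k \<in> {1..m}"
  shows "coefficient m (sign_form m k e) f = (\<Sum>S\<in>Pow ({1..m} - {k}). (if f k = e S then 1 else 0) *
    (\<Prod>l\<in>{1..m} - {k}. (if f l = 0 then 1 else 0) + (if l \<in> S then -1 else 1) * (if f l = 1 then 1 else 0)))"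
  unfolding coefficient_def sign_form_def using assms
  by (intro sum.cong arg_cong2[where f = "(*)"] prod.cong) (auto simp: c0_basis.rep_eq)

lemma coefficient_sign_form_eq_0:
  assumes "k \<in> {1..m}" "coefficient m (sign_form m k e) f \<noteq> 0"
  shows "f k \<in> e ` Pow ({1..m} - {k})" "l \<in> {1..m} - {k} \<Longrightarrow> f l < 2"
proof -
  obtain S where S: "S \<in> Pow ({1..m} - {k})" and ne: "(if f k = e S then 1 else 0) *
    (\<Prod>l\<in>{1..m} - {k}. (if f l = 0 then 1 else 0) + (if l \<in> S then -1 else 1) * (if f l = 1 then 1 else 0)) \<noteq> (0::real)"
    using assms(2) unfolding coefficient_sign_form[OF assms(1)] by (rule sum.not_neutral_contains_not_neutral)
  show "f k \<in> e ` Pow ({1..m} - {k})" using S ne by (auto split: if_splits)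
  show "f l < 2" if l: "l \<in> {1..m} - {k}"
  proof (rule ccontr)
    assume "\<not> f l < 2"
    then have "(\<Prod>l\<in>{1..m} - {k}. (if f l = 0 then 1 else 0) + (if l \<in> S then -1 else 1) * (if f l = 1 then 1 else 0)) = (0::real)"
      using l by (intro prod_zero bexI[of _ l]) auto
    then show False using ne by simp
  qed
qed

text \<open>The index in slot \<open>k\<close> selects a single pattern, and each of the other indices selects one of the
  two terms \<open>\<plusminus>1\<close> in its factor.\<close>

lemma abs_coefficient_sign_form:
  assumes "k \<in> {1..m}" "inj_on e (Pow ({1..m} - {k}))"
    and f: "f k \<in> e ` Pow ({1..m} - {k})" "\<And>l. l \<in> {1..m} - {k} \<Longrightarrow> f l < 2"
  shows "\<bar>coefficient m (sign_form m k e) f\<bar> = 1"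
proof -
  let ?K = "{1..m} - {k}"
  let ?h = "\<lambda>S l. (if f l = 0 then 1 else 0) + (if l \<in> S then -1 else 1) * (if f l = 1 then 1 else (0::real))"
  obtain S where S: "S \<in> Pow ?K" "f k = e S" using f(1) by blast
  have "coefficient m (sign_form m k e) f = (\<Sum>S'\<in>Pow ?K. if S' = S then prod (?h S') ?K else 0)"
    unfolding coefficient_sign_form[OF assms(1)]
    using S assms(2) by (intro sum.cong) (auto simp: inj_on_eq_iff)
  also have "\<dots> = prod (?h S) ?K" using S(1) by (simp add: sum.delta)
  finally have "\<bar>coefficient m (sign_form m k e) f\<bar> = (\<Prod>l\<in>?K. \<bar>?h S l\<bar>)"
    by (simp add: abs_prod)
  also have "\<dots> = (\<Prod>l\<in>?K. 1)"
  proof (rule prod.cong)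
    fix l assume "l \<in> ?K"
    then have "f l = 0 \<or> f l = 1" using f(2)[of l] by auto
    then show "\<bar>?h S l\<bar> = 1" by auto
  qed simp
  finally show ?thesis by simp
qed

text \<open>The coefficients are \<open>\<plusminus>1\<close> on a box of side \<open>2\<^sup>m\<^sup>-\<^sup>1\<close> in slot \<open>k\<close>, where the exponent is 1, and of
  side 2 in the other slots, where it is 2. A box has the same mixed norm whatever the position
  of the slot with exponent 1, which is why one form serves every \<open>k\<close> without a rearrangement.\<close>

lemma mixed_norm_sign_form_ge:
  assumes m: "2 \<le> m" and k: "k \<in> {1..m}" and e: "bij_betw e (Pow ({1..m} - {k})) {..<2 ^ (m - 1)}"
  shows "ennreal (sqrt 2 ^ (m - 1) * 2 ^ (m - 1)) \<le> mixed_norm m (one_two_tuple k) (sign_form m k e)"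
proof -
  let ?K = "{1..m} - {k}" and ?M = "2 ^ (m - 1) :: nat"
  let ?q = "one_two_tuple k"
  let ?N = "\<lambda>l. if l = k then ?M else 2"
  \<comment> \<open>The truncation at \<open>?M\<close> has to contain the side 2 of the box as well.\<close>
  have "2 ^ 1 \<le> ?M" using m by (intro power_increasing) auto
  then have M: "2 \<le> ?M" by simp
  have set: "set [1..<Suc m] = {1..m}" by auto
  have "(\<Prod>l\<in>set [1..<Suc m]. real (?N l) powr (1 / ?q l))
      \<le> trunc_norm ?M ?q (coefficient m (sign_form m k e)) [1..<Suc m] (\<lambda>_. undefined)"
  proof (rule trunc_norm_ge)
    fix f :: "nat \<Rightarrow> nat" assume *: "\<And>l. l \<in> set [1..<Suc m] \<Longrightarrow> f l < ?N l"
    have f: "f l < ?N l" if "l \<in> {1..m}" for l using *[of l] that unfolding set by blast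
    have "\<bar>coefficient m (sign_form m k e) f\<bar> = 1"
    proof (rule abs_coefficient_sign_form[OF k])
      show "inj_on e (Pow ?K)" using e by (rule bij_betw_imp_inj_on)
      show "f k \<in> e ` Pow ?K" using f[OF k] bij_betw_imp_surj_on[OF e] by simp
      show "f l < 2" if "l \<in> ?K" for l using f[of l] that by simp
    qed
    then show "1 \<le> \<bar>coefficient m (sign_form m k e) f\<bar>" by simp
  qed (use M in \<open>auto simp: one_two_tuple_pos\<close>)
  moreover have "(\<Prod>l\<in>set [1..<Suc m]. real (?N l) powr (1 / ?q l)) = sqrt 2 ^ (m - 1) * 2 ^ (m - 1)"
  proof -
    have "(\<Prod>l\<in>?K. real (?N l) powr (1 / ?q l)) = (\<Prod>l\<in>?K. sqrt 2)"
      by (intro prod.cong) (auto simp: one_two_tuple_def powr_half_sqrt)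
    then show ?thesis
      unfolding set using k by (subst prod.remove[of _ k]) (auto simp: one_two_tuple_def)
  qed
  ultimately have "ennreal (sqrt 2 ^ (m - 1) * 2 ^ (m - 1))
      \<le> ennreal (trunc_norm ?M ?q (coefficient m (sign_form m k e)) [1..<Suc m] (\<lambda>_. undefined))"
    by (intro ennreal_leI) simp
  also have "\<dots> \<le> mixed_norm m ?q (sign_form m k e)"
    using m by (subst mixed_norm_eq_SUP) (auto simp: one_two_tuple_pos intro!: SUP_upper)
  finally show ?thesis .
qed

lemma ecard_support_sign_form_le:
  assumes k: "k \<in> {1..m}" and e: "bij_betw e (Pow ({1..m} - {k})) {..<2 ^ (m - 1)}"
  shows "ecard {i \<in> tuples m. coefficient m (sign_form m k e) i \<noteq> 0} \<le> enat (4 ^ (m - 1))"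
proof -
  let ?K = "{1..m} - {k}" and ?A = "{i \<in> tuples m. coefficient m (sign_form m k e) i \<noteq> 0}"
  let ?N = "\<lambda>l. if l = k then 2 ^ (m - 1) else 2 :: nat"
  let ?B = "\<Pi>\<^sub>E l\<in>{1..m}. {..<?N l}"
  have sub: "?A \<subseteq> ?B"
  proof
    fix f assume f: "f \<in> ?A"
    then have ne: "coefficient m (sign_form m k e) f \<noteq> 0" by simp
    have "f l < ?N l" if "l \<in> {1..m}" for l
      using coefficient_sign_form_eq_0(1)[OF k ne] coefficient_sign_form_eq_0(2)[OF k ne, of l]
        bij_betw_imp_surj_on[OF e] that by auto
    then show "f \<in> ?B" using f by (auto simp: tuples_def PiE_def)
  qed
  have fin: "finite ?B" by (intro finite_PiE) auto
  have "card ?B = (\<Prod>l\<in>{1..m}. ?N l)" by (simp add: card_PiE)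
  also have "\<dots> = 2 ^ (m - 1) * (\<Prod>l\<in>?K. ?N l)"
    using k by (subst prod.remove[of _ k]) auto
  also have "(\<Prod>l\<in>?K. ?N l) = (\<Prod>l\<in>?K. 2)" by (rule prod.cong) auto
  also have "2 ^ (m - 1) * \<dots> = (4 ^ (m - 1) :: nat)"
    using k by (simp add: power_mult_distrib[symmetric])
  finally have "card ?A \<le> 4 ^ (m - 1)" using card_mono[OF fin sub] by simp
  then show ?thesis using finite_subset[OF sub fin] by (simp add: ecard_def)
qed

section \<open>The optimal constant and the entropy\<close>

lemma bounded_by_form_norm:
  assumes "cont_multilinear_form m T" "1 \<le> m"
  obtains B where "0 \<le> B" "form_norm m T = ennreal B" "bounded_by m B T"
proof
  have "form_norm m T = ennreal (enn2real (form_norm m T))"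
    using form_norm_finite[OF assms] by simp
  then show "form_norm m T = ennreal (enn2real (form_norm m T))"
    and "bounded_by m (enn2real (form_norm m T)) T" "0 \<le> enn2real (form_norm m T)"
    by (simp_all add: bounded_by_iff)
qed

lemma bh_admissible_sqrt_2:
  assumes "k \<in> {1..m}"
  shows "bh_admissible m (one_two_tuple k) (ennreal (sqrt 2 ^ (m - 1)))"
  unfolding bh_admissible_def
proof (intro allI impI)
  fix T assume T: "cont_multilinear_form m T"
  obtain B where B: "0 \<le> B" "form_norm m T = ennreal B" "bounded_by m B T"
    using bounded_by_form_norm[OF T] assms by auto
  show "mixed_norm m (one_two_tuple k) T \<le> ennreal (sqrt 2 ^ (m - 1)) * form_norm m T"
    using mixed_norm_le[OF T assms B(3)] B by (simp add: ennreal_mult)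
qed

lemma ex_bij_Pow_slots:
  assumes "k \<in> {1..m}"
  obtains e :: "nat set \<Rightarrow> nat" where "bij_betw e (Pow ({1..m} - {k})) {..<2 ^ (m - 1)}"
proof -
  have "card (Pow ({1..m} - {k})) = 2 ^ (m - 1)" using assms by (simp add: card_Pow)
  then show ?thesis
    using that finite_same_card_bij[of "Pow ({1..m} - {k})" "{..<2 ^ (m - 1)} :: nat set"] by auto
qed

lemma bh_const_one_two:
  assumes m: "2 \<le> m" and k: "k \<in> {1..m}"
  shows "bh_const m (one_two_tuple k) = ennreal (sqrt 2 ^ (m - 1))"
proof (rule antisym)
  show "bh_const m (one_two_tuple k) \<le> ennreal (sqrt 2 ^ (m - 1))"
    unfolding bh_const_def using bh_admissible_sqrt_2[OF k] by (intro Inf_lower) simp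
  obtain e :: "nat set \<Rightarrow> nat" where e: "bij_betw e (Pow ({1..m} - {k})) {..<2 ^ (m - 1)}"
    using ex_bij_Pow_slots[OF k] .
  show "ennreal (sqrt 2 ^ (m - 1)) \<le> bh_const m (one_two_tuple k)"
    unfolding bh_const_def
  proof (rule Inf_greatest)
    fix C assume "C \<in> {C. bh_admissible m (one_two_tuple k) C}"
    then have "mixed_norm m (one_two_tuple k) (sign_form m k e) \<le> C * form_norm m (sign_form m k e)"
      using sign_form_cont_multilinear[OF k] by (simp add: bh_admissible_def)
    also have "\<dots> \<le> C * ennreal (2 ^ (m - 1))"
      using bounded_by_sign_form[OF k] by (intro mult_left_mono) (simp_all add: bounded_by_iff)
    finally have "ennreal (2 ^ (m - 1)) * ennreal (sqrt 2 ^ (m - 1)) \<le> ennreal (2 ^ (m - 1)) * C"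
      using mixed_norm_sign_form_ge[OF m k e] by (simp add: ennreal_mult[symmetric] mult.commute)
    then show "ennreal (sqrt 2 ^ (m - 1)) \<le> C"
      by (subst (asm) ennreal_mult_le_mult_iff) (auto simp: ennreal_eq_0_iff not_le)
  qed
qed

lemma bh_extremal_sign_form:
  assumes m: "2 \<le> m" and k: "k \<in> {1..m}" and e: "bij_betw e (Pow ({1..m} - {k})) {..<2 ^ (m - 1)}"
  shows "bh_extremal m (one_two_tuple k) (sign_form m k e)"
  unfolding bh_extremal_def
proof (intro conjI)
  let ?T = "sign_form m k e"
  show cont: "cont_multilinear_form m ?T" by (rule sign_form_cont_multilinear[OF k])
  have "\<bar>coefficient m ?T (\<lambda>_. 0)\<bar> = 1"
    using e by (intro abs_coefficient_sign_form[OF k]) (auto simp: bij_betw_def)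
  then show "\<exists>x\<in>tuples m. ?T x \<noteq> 0"
    unfolding coefficient_eq
    by (intro bexI[of _ "basis_tuple m (\<lambda>_. 0)"]) (auto simp: basis_tuple_in_tuples)
  show "mixed_norm m (one_two_tuple k) ?T = bh_const m (one_two_tuple k) * form_norm m ?T"
    unfolding bh_const_one_two[OF m k]
  proof (rule antisym)
    show "mixed_norm m (one_two_tuple k) ?T \<le> ennreal (sqrt 2 ^ (m - 1)) * form_norm m ?T"
      using bh_admissible_sqrt_2[OF k] cont by (simp add: bh_admissible_def)
    have "ennreal (sqrt 2 ^ (m - 1)) * form_norm m ?T \<le> ennreal (sqrt 2 ^ (m - 1)) * ennreal (2 ^ (m - 1))"
      using bounded_by_sign_form[OF k] by (intro mult_left_mono) (simp_all add: bounded_by_iff)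
    then show "ennreal (sqrt 2 ^ (m - 1)) * form_norm m ?T \<le> mixed_norm m (one_two_tuple k) ?T"
      using mixed_norm_sign_form_ge[OF m k e] by (simp add: ennreal_mult[symmetric])
  qed
qed

text \<open>The mixed norm of an extremal form equals \<open>(\<surd>2)\<^sup>m\<^sup>-\<^sup>1 \<parallel>T\<parallel>\<close> and is at most \<open>\<surd>s \<parallel>T\<parallel>\<close>, where \<open>s\<close> is the
  size of the support; \<open>\<parallel>T\<parallel>\<close> can be cancelled, being finite and positive.\<close>

lemma card_support_extremal_ge:
  assumes m: "2 \<le> m" and k: "k \<in> {1..m}" and T: "bh_extremal m (one_two_tuple k) T"
    and fin: "finite {i \<in> tuples m. coefficient m T i \<noteq> 0}"
  shows "2 ^ (m - 1) \<le> card {i \<in> tuples m. coefficient m T i \<noteq> 0}"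
proof -
  let ?s = "card {i \<in> tuples m. coefficient m T i \<noteq> 0}"
  have cont: "cont_multilinear_form m T" using T by (simp add: bh_extremal_def)
  obtain B where B: "0 \<le> B" "form_norm m T = ennreal B" "bounded_by m B T"
    using bounded_by_form_norm[OF cont] m by auto
  have "0 < form_norm m T"
    using T form_norm_pos[OF cont_multilinear_linear_in[OF cont]] by (auto simp: bh_extremal_def)
  then have "0 < B" using B by simp
  have "mixed_norm m (one_two_tuple k) T = ennreal (sqrt 2 ^ (m - 1)) * ennreal B"
    using T bh_const_one_two[OF m k] B(2) by (simp add: bh_extremal_def)
  then have "ennreal (sqrt 2 ^ (m - 1) * B) \<le> ennreal (sqrt ?s * B)"
    using mixed_norm_le_support[OF cont k B(3) fin] B(1) by (simp add: ennreal_mult)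
  then have "sqrt 2 ^ (m - 1) * B \<le> sqrt ?s * B"
    using B(1) by (subst (asm) ennreal_le_iff) auto
  then have "sqrt (2 ^ (m - 1)) \<le> sqrt ?s"
    using \<open>0 < B\<close> by (simp add: real_sqrt_power)
  then have "real (2 ^ (m - 1)) \<le> real ?s" by simp
  then show ?thesis by (simp only: of_nat_le_iff)
qed

lemma enat_power: "enat (a ^ n) = enat a ^ n"
  by (induction n) (simp_all add: one_enat_def flip: times_enat_simps(1))

theorem corollary4p2:
  fixes m :: nat
  assumes "m \<ge> 2"
  shows "(\<forall>k\<in>{1..m}. bh_const m (one_two_tuple k) = ennreal (sqrt 2 ^ (m - 1))) \<and>
         (\<forall>k\<in>{1..m}. 2 ^ (m - 1) \<le> entropy m (one_two_tuple k) \<and>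
                      entropy m (one_two_tuple k) \<le> 4 ^ (m - 1))"
proof (intro conjI ballI)
  fix k assume k: "k \<in> {1..m}"
  show "bh_const m (one_two_tuple k) = ennreal (sqrt 2 ^ (m - 1))"
    by (rule bh_const_one_two[OF assms k])
  show "2 ^ (m - 1) \<le> entropy m (one_two_tuple k)"
    unfolding entropy_def
  proof (rule INF_greatest)
    fix T assume "T \<in> {T. bh_extremal m (one_two_tuple k) T}"
    then have "enat (2 ^ (m - 1)) \<le> ecard {i \<in> tuples m. coefficient m T i \<noteq> 0}"
      using card_support_extremal_ge[OF assms k] by (simp add: ecard_def)
    then show "2 ^ (m - 1) \<le> ecard {i \<in> tuples m. coefficient m T i \<noteq> 0}"
      by (simp add: enat_power numeral_eq_enat)
  qed
  obtain e :: "nat set \<Rightarrow> nat" where e: "bij_betw e (Pow ({1..m} - {k})) {..<2 ^ (m - 1)}"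
    using ex_bij_Pow_slots[OF k] .
  have "entropy m (one_two_tuple k) \<le> ecard {i \<in> tuples m. coefficient m (sign_form m k e) i \<noteq> 0}"
    unfolding entropy_def using bh_extremal_sign_form[OF assms k e] by (intro INF_lower) simp
  also have "\<dots> \<le> enat (4 ^ (m - 1))" by (rule ecard_support_sign_form_le[OF k e])
  finally show "entropy m (one_two_tuple k) \<le> 4 ^ (m - 1)"
    by (simp add: enat_power numeral_eq_enat)
qed

end
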